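(* Let $m\ge 3$, let $U$ be an $m$-dimensional domain and let $f:U\to\mathbb{R}^{m+1}$ be a front all of whose singular points are $A_2$-singular points. Let $\Sigma_f$ be the singular set of $f$ and let $K$ be the sectional curvature of the metric induced by $f$ on the set $U\setminus\Sigma_f$ of regular points. If $K$ is positive everywhere on $U\setminus\Sigma_f$, then the sectional curvature of the singular submanifold $\Sigma_f$ (with the metric induced by $f$) is non-negative. Furthermore, if $K\ge\delta$ on $U\setminus\Sigma_f$ for some constant $\delta>0$, then the sectional curvature of the singular submanifold $\Sigma_f$ is positive.
   Context: Everything is $C^\infty$. A map $f:U\to\mathbb{R}^{m+1}$ is a (wave) front if each $p\in U$ has a neighbourhood $W$ with a smooth unit normal field $\nu:W\to S^m$, $\langle df(X),\nu\rangle=0$ for all $X\in TW$, such that $(f,\nu):W\to\mathbb{R}^{m+1}\times S^m$ is an immersion. The singular set $\Sigma_f$ is the set of points where $f$ is not an immersion. In local coordinates $(u_1,\dots,u_m)$ put $\lambda=\det(f_{u_1},\dots,f_{u_m},\nu)$; locally $\Sigma_f=\{\lambda=0\}$. A singular point $p$ is non-degenerate if $d\lambda(p)\neq0$; then near $p$ the set $\Sigma_f$ is an $(m-1)$-dimensional submanifold (the singular submanifold) and $\ker df$ is one-dimensional along it (the null direction). A non-degenerate singular point is an $A_2$-singular point if the null direction there is transversal to $\Sigma_f$. If all singular points are $A_2$-points, then $f|_{\Sigma_f}$ is an immersion, and $\Sigma_f$ carries the Riemannian metric induced by $f|_{\Sigma_f}$. *)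

theory Defs
  imports "HOL-Analysis.Analysis" "HOL-Library.Set_Algebras"
begin

section \<open>Smooth maps\<close>

text \<open>These notions are meant for open sets \<open>S\<close>. Since the domain is finite-dimensional,
  continuity of all iterated directional derivatives is continuity of the higher derivatives.\<close>

primrec Ck_on :: "nat \<Rightarrow> 'a::euclidean_space set \<Rightarrow> ('a \<Rightarrow> 'b::real_normed_vector) \<Rightarrow> bool" where
  "Ck_on 0 S h \<longleftrightarrow> continuous_on S h"
| "Ck_on (Suc k) S h \<longleftrightarrow>
     (\<forall>x\<in>S. h differentiable (at x)) \<and> (\<forall>v. Ck_on k S (\<lambda>x. frechet_derivative h (at x) v))"

definition smooth_on :: "'a::euclidean_space set \<Rightarrow> ('a \<Rightarrow> 'b::real_normed_vector) \<Rightarrow> bool" where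
  "smooth_on S h \<longleftrightarrow> (\<forall>k. Ck_on k S h)"

definition immersion_at :: "('a::euclidean_space \<Rightarrow> 'b::real_normed_vector) \<Rightarrow> 'a \<Rightarrow> bool" where
  "immersion_at h p \<longleftrightarrow> h differentiable (at p) \<and> inj (frechet_derivative h (at p))"

section \<open>Embedded submanifolds\<close>

definition tangent_space_at :: "'a::euclidean_space set \<Rightarrow> 'a \<Rightarrow> 'a set" where
  "tangent_space_at S p =
     {v. \<exists>\<gamma> e. e > 0 \<and> smooth_on {-e<..<e::real} \<gamma> \<and> \<gamma> ` {-e<..<e} \<subseteq> S \<and> \<gamma> 0 = p \<and>
          (\<gamma> has_vector_derivative v) (at 0)}"

definition local_parametrization ::
    "'a::euclidean_space set \<Rightarrow> 'b::euclidean_space set \<Rightarrow> ('b \<Rightarrow> 'a) \<Rightarrow> bool" where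
  "local_parametrization S V \<phi> \<longleftrightarrow>
     open V \<and> smooth_on V \<phi> \<and> (\<forall>y\<in>V. immersion_at \<phi> y) \<and>
     openin (top_of_set S) (\<phi> ` V) \<and> (\<exists>\<psi>. homeomorphism V (\<phi> ` V) \<phi> \<psi>)"

section \<open>Sectional curvature of a Riemannian metric on an open set\<close>

text \<open>A metric is a map \<open>g\<close> such that \<open>g x v w\<close> is the inner product of \<open>v\<close> and \<open>w\<close> at \<open>x\<close>.\<close>

definition induced_metric ::
    "('a::euclidean_space \<Rightarrow> 'b::real_inner) \<Rightarrow> 'a \<Rightarrow> 'a \<Rightarrow> 'a \<Rightarrow> real" where
  "induced_metric h x v w = frechet_derivative h (at x) v \<bullet> frechet_derivative h (at x) w"

text \<open>The Levi-Civita covariant derivative of the constant field \<open>w\<close> in the constant direction \<open>v\<close>.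
  The Koszul formula has no bracket terms because constant fields commute; on coordinate
  fields the result is the usual vector of Christoffel symbols. The vector \<open>z\<close> is uniquely
  determined where \<open>g x\<close> is positive definite.\<close>

definition christoffel ::
    "('a::euclidean_space \<Rightarrow> 'a \<Rightarrow> 'a \<Rightarrow> real) \<Rightarrow> 'a \<Rightarrow> 'a \<Rightarrow> 'a \<Rightarrow> 'a" where
  "christoffel g x v w = (THE z. \<forall>u. 2 * g x z u =
       frechet_derivative (\<lambda>y. g y w u) (at x) v
     + frechet_derivative (\<lambda>y. g y v u) (at x) w
     - frechet_derivative (\<lambda>y. g y v w) (at x) u)"

text \<open>\<open>R(u,v)w = \<nabla>\<^sub>u \<nabla>\<^sub>v w - \<nabla>\<^sub>v \<nabla>\<^sub>u w\<close> for constant fields \<open>u, v, w\<close>.\<close>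

definition riemann_curvature ::
    "('a::euclidean_space \<Rightarrow> 'a \<Rightarrow> 'a \<Rightarrow> real) \<Rightarrow> 'a \<Rightarrow> 'a \<Rightarrow> 'a \<Rightarrow> 'a \<Rightarrow> 'a" where
  "riemann_curvature g x u v w =
       (frechet_derivative (\<lambda>y. christoffel g y v w) (at x) u
          + christoffel g x u (christoffel g x v w))
     - (frechet_derivative (\<lambda>y. christoffel g y u w) (at x) v
          + christoffel g x v (christoffel g x u w))"

definition sectional_curvature ::
    "('a::euclidean_space \<Rightarrow> 'a \<Rightarrow> 'a \<Rightarrow> real) \<Rightarrow> 'a \<Rightarrow> 'a \<Rightarrow> 'a \<Rightarrow> real" where
  "sectional_curvature g x v w =
     g x (riemann_curvature g x v w w) v / (g x v v * g x w w - (g x v w)\<^sup>2)"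

definition sectional_curvatures_at ::
    "('a::euclidean_space \<Rightarrow> 'a \<Rightarrow> 'a \<Rightarrow> real) \<Rightarrow> 'a \<Rightarrow> real set" where
  "sectional_curvatures_at g x = {sectional_curvature g x v w | v w. v \<noteq> w \<and> independent {v, w}}"

section \<open>Fronts\<close>

text \<open>With \<open>m = CARD('m)\<close>, the target space of dimension \<open>m + 1\<close> is \<open>real ^ 'm option\<close>:
  in the matrix \<open>(f\<^sub>u\<^sub>1, \<dots>, f\<^sub>u\<^sub>m, \<nu>)\<close> the index \<open>Some k\<close> is the \<open>k\<close>-th column and
  \<open>None\<close> the last one. Reordering the indices only changes the sign of the determinant.\<close>

definition front_normal ::
    "(real ^ 'm \<Rightarrow> real ^ 'm option) \<Rightarrow> (real ^ 'm) set \<Rightarrow> (real ^ 'm \<Rightarrow> real ^ 'm option) \<Rightarrow> bool"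
  where
  "front_normal f W \<nu> \<longleftrightarrow>
     smooth_on W \<nu> \<and> (\<forall>x\<in>W. norm (\<nu> x) = 1) \<and>
     (\<forall>x\<in>W. \<forall>v. frechet_derivative f (at x) v \<bullet> \<nu> x = 0) \<and>
     (\<forall>x\<in>W. immersion_at (\<lambda>y. (f y, \<nu> y)) x)"

definition front :: "(real ^ 'm) set \<Rightarrow> (real ^ 'm \<Rightarrow> real ^ 'm option) \<Rightarrow> bool" where
  "front U f \<longleftrightarrow> smooth_on U f \<and>
     (\<forall>p\<in>U. \<exists>W \<nu>. open W \<and> p \<in> W \<and> W \<subseteq> U \<and> front_normal f W \<nu>)"

definition singular_set :: "(real ^ 'm) set \<Rightarrow> (real ^ 'm \<Rightarrow> real ^ 'm option) \<Rightarrow> (real ^ 'm) set"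
  where "singular_set U f = {p \<in> U. \<not> immersion_at f p}"

definition signed_density ::
    "(real ^ 'm \<Rightarrow> real ^ 'm option) \<Rightarrow> (real ^ 'm \<Rightarrow> real ^ 'm option) \<Rightarrow> real ^ 'm \<Rightarrow> real"
  where
  "signed_density f \<nu> x =
     det (\<chi> i j. case j of Some k \<Rightarrow> frechet_derivative f (at x) (axis k 1) $ i | None \<Rightarrow> \<nu> x $ i)"

text \<open>Non-degeneracy does not depend on the normal field: if it holds for some \<open>\<nu>\<close>, then
  regular points are dense near \<open>p\<close> and the normal field is unique up to sign there.\<close>

definition nondegenerate_singular ::
    "(real ^ 'm) set \<Rightarrow> (real ^ 'm \<Rightarrow> real ^ 'm option) \<Rightarrow> real ^ 'm \<Rightarrow> bool" where
  "nondegenerate_singular U f p \<longleftrightarrow> p \<in> singular_set U f \<and>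
     (\<exists>W \<nu>. open W \<and> p \<in> W \<and> W \<subseteq> U \<and> front_normal f W \<nu> \<and>
        frechet_derivative (signed_density f \<nu>) (at p) \<noteq> (\<lambda>_. 0))"

text \<open>The last conjunct is transversality: the null space of \<open>df\<close> (a line at a non-degenerate
  point) and the tangent space of the singular set span the whole space.\<close>

definition A2_singular ::
    "(real ^ 'm) set \<Rightarrow> (real ^ 'm \<Rightarrow> real ^ 'm option) \<Rightarrow> real ^ 'm \<Rightarrow> bool" where
  "A2_singular U f p \<longleftrightarrow> nondegenerate_singular U f p \<and>
     {v. frechet_derivative f (at p) v = 0} + tangent_space_at (singular_set U f) p = UNIV"

end

theory Submission
  imports Defs
begin

text \<open>
  At a regular point the Gauss equation turns a lower bound \<open>\<delta>\<close> for the sectional curvature into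
  \<open>II(v,v) II(w,w) - II(v,w)\<^sup>2 \<ge> \<delta> (|df v|\<^sup>2 |df w|\<^sup>2 - \<langle>df v, df w\<rangle>\<^sup>2)\<close>, where
  \<open>II(v,w) = \<langle>D\<^sub>v D\<^sub>w f, \<nu>\<rangle> = - \<langle>df w, d\<nu> v\<rangle>\<close> is defined at singular points as well. The proof follows this
  inequality along the straight line \<open>p + t \<eta>\<close> through a singular point \<open>p\<close> in its null direction \<open>\<eta>\<close>.
  Put \<open>n = d\<nu>(\<eta>)\<close> and \<open>h = D\<^sub>\<eta> D\<^sub>\<eta> f\<close>, both taken at \<open>p\<close>. Then \<open>df(\<eta>) = t h + o(t)\<close> on the line, hence
  \<open>II(\<eta>,\<eta>) = - t \<langle>h, n\<rangle> + o(t)\<close> and \<open>II(\<eta>,w) = O(t)\<close>, while the Gram determinant of \<open>\<eta>\<close> and \<open>w\<close> is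
  \<open>t\<^sup>2 (|h|\<^sup>2 |df w|\<^sup>2 - \<langle>h, df w\<rangle>\<^sup>2) + o(t\<^sup>2)\<close>. Being an \<open>A\<^sub>2\<close> point means that the signed density has a nonzero
  derivative along \<open>\<eta>\<close>; this derivative is, up to a factor, the determinant of the frame in which a column
  of \<open>df\<close> has been replaced by \<open>h\<close> (\<open>null_derivative_density\<close>), and its being nonzero forces, for a front, \<open>\<langle>h, n\<rangle> \<noteq> 0\<close>.

  To first order in \<open>t\<close> the inequality reads \<open>- t \<langle>h, n\<rangle> II(w,w) \<ge> 0\<close>. As \<open>t\<close> takes both signs, \<open>II(w,w) = 0\<close> at \<open>p\<close>:
  the second fundamental form vanishes along the whole singular set (\<open>second_form_vanishes\<close>).

  To second order it then bounds the derivative of \<open>II(w,w)\<close> along \<open>\<eta>\<close>. Differentiating the identity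
  \<open>\<langle>df a, d\<nu> b\<rangle> = 0\<close> along the singular set shows that this derivative is \<open>\<langle>D\<^sub>w D\<^sub>w f, n\<rangle>\<close> for \<open>w\<close> tangent to the
  singular set. So \<open>- \<langle>h, n\<rangle> \<langle>D\<^sub>w D\<^sub>w f, n\<rangle>\<close> is at least \<open>\<delta> (|h|\<^sup>2 |df w|\<^sup>2 - \<langle>h, df w\<rangle>\<^sup>2)\<close>: it is nonnegative,
  and positive if \<open>\<delta> > 0\<close> and \<open>w \<noteq> 0\<close> (\<open>singular_curvature_bound\<close>).

  The restriction of \<open>f\<close> to the singular set has codimension two, with normal plane spanned by \<open>\<nu>\<close> and \<open>n\<close>.
  The \<open>\<nu>\<close>-component of its second fundamental form is \<open>II\<close> and hence zero. By the Gauss equation its curvature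
  has the sign of the \<open>2 \<times> 2\<close> minors of the form \<open>\<langle>D\<^sub>v D\<^sub>w f, n\<rangle>\<close>, and the minors of a semidefinite (definite) form
  are nonnegative (positive). Positive curvature without a uniform bound is the case \<open>\<delta> = 0\<close>.
\<close>

section \<open>Directional derivatives and smooth maps\<close>

abbreviation dirderiv :: "('a::euclidean_space \<Rightarrow> 'b::real_normed_vector) \<Rightarrow> 'a \<Rightarrow> 'a \<Rightarrow> 'b" where
  "dirderiv h v \<equiv> (\<lambda>x. frechet_derivative h (at x) v)"

lemma has_derivative_dirderiv:
  assumes "h differentiable (at x)"
  shows "(h has_derivative (\<lambda>v. dirderiv h v x)) (at x)"
  using assms frechet_derivative_works by auto

lemma dirderiv_eqI:
  assumes "(h has_derivative h') (at x)"
  shows "dirderiv h v x = h' v"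
  using frechet_derivative_at[OF assms] by simp

lemma linear_dirderiv:
  assumes "h differentiable (at x)"
  shows "linear (\<lambda>v. dirderiv h v x)"
  using linear_frechet_derivative[OF assms] by simp

lemma Ck_on_dirderiv: "Ck_on (Suc k) S h \<Longrightarrow> Ck_on k S (dirderiv h v)"
  by simp

lemma Ck_on_SucD: "Ck_on (Suc k) S h \<Longrightarrow> Ck_on k S h"
proof (induction k arbitrary: h)
  case 0
  then show ?case
    by (simp add: differentiable_imp_continuous_on differentiable_at_imp_differentiable_on)
next
  case (Suc k)
  then have "Ck_on k S (dirderiv h v)" for v
    using Suc.IH[of "dirderiv h v"] Suc.prems by simp
  then show ?case using Suc.prems by simp
qed

lemma Ck_on_le: "Ck_on k S h \<Longrightarrow> l \<le> k \<Longrightarrow> Ck_on l S h"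
proof (induction k)
  case 0 then show ?case by simp
next
  case (Suc k)
  show ?case
  proof (cases "l = Suc k")
    case False
    then show ?thesis using Suc.IH[OF Ck_on_SucD[OF Suc.prems(1)]] Suc.prems(2) by simp
  qed (use Suc.prems in simp)
qed

lemma Ck_on_continuous: "Ck_on k S h \<Longrightarrow> continuous_on S h"
  using Ck_on_le[of k S h 0] by simp

lemma Ck_on_subset: "Ck_on k S h \<Longrightarrow> T \<subseteq> S \<Longrightarrow> Ck_on k T h"
proof (induction k arbitrary: h)
  case 0
  then show ?case using continuous_on_subset[of S h T] by simp
next
  case (Suc k)
  then show ?case by auto
qed

lemma dirderiv_cong_open:
  assumes "open S" "x \<in> S" "\<And>y. y \<in> S \<Longrightarrow> f y = g y" "f differentiable (at x)"
  shows "g differentiable (at x)" "dirderiv g v x = dirderiv f v x"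
proof -
  have *: "(g has_derivative (\<lambda>v. dirderiv f v x)) (at x)"
    by (rule has_derivative_transform_within_open[OF has_derivative_dirderiv[OF assms(4)] assms(1,2)])
       (rule assms(3))
  show "g differentiable (at x)" by (rule differentiableI[OF *])
  show "dirderiv g v x = dirderiv f v x" by (rule dirderiv_eqI[OF *])
qed

lemma Ck_on_cong:
  assumes "open S" "\<And>y. y \<in> S \<Longrightarrow> f y = g y" "Ck_on k S f"
  shows "Ck_on k S g"
  using assms(2,3)
proof (induction k arbitrary: f g)
  case 0
  then show ?case using continuous_on_cong[of S S f g] by auto
next
  case (Suc k)
  have "Ck_on k S (dirderiv g v)" for v
  proof (rule Suc.IH[of "dirderiv f v"])
    fix y assume "y \<in> S"
    then show "dirderiv f v y = dirderiv g v y"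
      using dirderiv_cong_open(2)[OF assms(1), of y f g v] Suc.prems by auto
  qed (use Suc.prems in auto)
  moreover have "g differentiable (at x)" if "x \<in> S" for x
    using dirderiv_cong_open(1)[OF assms(1), of x f g] Suc.prems that by auto
  ultimately show ?case by simp
qed

lemma Ck_on_const: "Ck_on k S (\<lambda>x. c)"
  by (induction k arbitrary: c) auto

lemma dirderiv_add:
  assumes "f differentiable (at x)" "g differentiable (at x)"
  shows "dirderiv (\<lambda>y. f y + g y) v x = dirderiv f v x + dirderiv g v x"
  by (rule dirderiv_eqI[OF has_derivative_add[OF has_derivative_dirderiv[OF assms(1)] has_derivative_dirderiv[OF assms(2)]]])

lemma Ck_on_add:
  assumes "open S" "Ck_on k S f" "Ck_on k S g"
  shows "Ck_on k S (\<lambda>x. f x + g x)"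
  using assms(2,3)
proof (induction k arbitrary: f g)
  case 0 then show ?case by (auto intro: continuous_on_add)
next
  case (Suc k)
  have "Ck_on k S (dirderiv (\<lambda>x. f x + g x) v)" for v
    by (rule Ck_on_cong[OF assms(1) _ Suc.IH[of "dirderiv f v" "dirderiv g v"]])
       (use Suc.prems dirderiv_add[of f _ g v] in auto)
  then show ?case using Suc.prems by auto
qed

lemma Ck_on_sum:
  assumes "open S" "\<And>i. i \<in> I \<Longrightarrow> Ck_on k S (f i)"
  shows "Ck_on k S (\<lambda>x. \<Sum>i\<in>I. f i x)"
  using assms(2)
  by (induction I rule: infinite_finite_induct) (auto simp: Ck_on_const intro!: Ck_on_add assms(1))

lemma dirderiv_bounded_linear:
  assumes "bounded_linear L" "f differentiable (at x)"
  shows "(\<lambda>y. L (f y)) differentiable (at x)" "dirderiv (\<lambda>y. L (f y)) v x = L (dirderiv f v x)"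
proof -
  have *: "((\<lambda>y. L (f y)) has_derivative (\<lambda>v. L (dirderiv f v x))) (at x)"
    by (rule bounded_linear.has_derivative[OF assms(1) has_derivative_dirderiv[OF assms(2)]])
  show "(\<lambda>y. L (f y)) differentiable (at x)" using * by (auto simp: differentiable_def)
  show "dirderiv (\<lambda>y. L (f y)) v x = L (dirderiv f v x)" by (rule dirderiv_eqI[OF *])
qed

lemma Ck_on_bounded_linear:
  assumes "open S" "bounded_linear L" "Ck_on k S f"
  shows "Ck_on k S (\<lambda>x. L (f x))"
  using assms(3)
proof (induction k arbitrary: f)
  case 0
  then show ?case by (auto intro: bounded_linear.continuous_on[OF assms(2)])
next
  case (Suc k)
  have "Ck_on k S (dirderiv (\<lambda>x. L (f x)) v)" for v
    by (rule Ck_on_cong[OF assms(1) _ Suc.IH[of "dirderiv f v"]])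
       (use Suc.prems dirderiv_bounded_linear(2)[OF assms(2), of f _ v] in auto)
  then show ?case using Suc.prems dirderiv_bounded_linear(1)[OF assms(2)] by auto
qed

lemma dirderiv_bilinear:
  assumes "bounded_bilinear mul" "f differentiable (at x)" "g differentiable (at x)"
  shows "(\<lambda>y. mul (f y) (g y)) differentiable (at x)"
    "dirderiv (\<lambda>y. mul (f y) (g y)) v x = mul (f x) (dirderiv g v x) + mul (dirderiv f v x) (g x)"
proof -
  have *: "((\<lambda>y. mul (f y) (g y)) has_derivative
      (\<lambda>v. mul (f x) (dirderiv g v x) + mul (dirderiv f v x) (g x))) (at x)"
    by (rule bounded_bilinear.FDERIV[OF assms(1) has_derivative_dirderiv[OF assms(2)]
          has_derivative_dirderiv[OF assms(3)]])
  show "(\<lambda>y. mul (f y) (g y)) differentiable (at x)" using * by (auto simp: differentiable_def)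
  show "dirderiv (\<lambda>y. mul (f y) (g y)) v x = mul (f x) (dirderiv g v x) + mul (dirderiv f v x) (g x)"
    by (rule dirderiv_eqI[OF *])
qed

lemmas dirderiv_inner = dirderiv_bilinear[OF bounded_bilinear_inner]

text \<open>The product rule expresses the derivative by products of the same kind one order lower, so every
  bilinear product preserves the class by induction on the order, simultaneously for all factors.\<close>

lemma Ck_on_bilinear:
  assumes "open S" "bounded_bilinear mul" "Ck_on k S f" "Ck_on k S g"
  shows "Ck_on k S (\<lambda>x. mul (f x) (g x))"
  using assms(3,4)
proof (induction k arbitrary: f g)
  case 0
  then show ?case by (auto intro: bounded_bilinear.continuous_on[OF assms(2)])
next
  case (Suc k)
  note f = Ck_on_SucD[OF Suc.prems(1)] and g = Ck_on_SucD[OF Suc.prems(2)]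
  have "Ck_on k S (dirderiv (\<lambda>x. mul (f x) (g x)) v)" for v
    by (rule Ck_on_cong[OF assms(1) _ Ck_on_add[OF assms(1)
            Suc.IH[OF f Ck_on_dirderiv[OF Suc.prems(2), of v]]
            Suc.IH[OF Ck_on_dirderiv[OF Suc.prems(1), of v] g]]])
       (use Suc.prems dirderiv_bilinear(2)[OF assms(2), of f _ g v] in auto)
  then show ?case using Suc.prems dirderiv_bilinear(1)[OF assms(2), of f _ g] by auto
qed

lemmas Ck_on_mult = Ck_on_bilinear[OF _ bounded_bilinear_mult]
lemmas Ck_on_inner = Ck_on_bilinear[OF _ bounded_bilinear_inner]

lemma Ck_on_prod:
  fixes f :: "'i \<Rightarrow> 'a::euclidean_space \<Rightarrow> real"
  assumes "open S" "\<And>i. i \<in> I \<Longrightarrow> Ck_on k S (f i)"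
  shows "Ck_on k S (\<lambda>x. \<Prod>i\<in>I. f i x)"
  using assms(2)
  by (induction I rule: infinite_finite_induct) (auto simp: Ck_on_const intro!: Ck_on_mult assms(1))

lemma Ck_on_det:
  fixes A :: "'a::euclidean_space \<Rightarrow> real ^ 'n ^ 'n"
  assumes "open S" "\<And>i j. Ck_on k S (\<lambda>x. A x $ i $ j)"
  shows "Ck_on k S (\<lambda>x. det (A x))"
  unfolding det_def
  by (intro Ck_on_sum Ck_on_mult Ck_on_const Ck_on_prod assms)

lemma dirderiv_compose:
  assumes "\<phi> differentiable (at x)" "f differentiable (at (\<phi> x))"
  shows "(f \<circ> \<phi>) differentiable (at x)"
    "dirderiv (f \<circ> \<phi>) v x = dirderiv f (dirderiv \<phi> v x) (\<phi> x)"
proof -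
  have *: "((f \<circ> \<phi>) has_derivative (\<lambda>v. dirderiv f (dirderiv \<phi> v x) (\<phi> x))) (at x)"
    using diff_chain_at[OF has_derivative_dirderiv[OF assms(1)] has_derivative_dirderiv[OF assms(2)]]
    by (simp add: o_def)
  show "(f \<circ> \<phi>) differentiable (at x)" using * by (auto simp: differentiable_def)
  show "dirderiv (f \<circ> \<phi>) v x = dirderiv f (dirderiv \<phi> v x) (\<phi> x)"
    by (rule dirderiv_eqI[OF *])
qed

lemma dirderiv_basis_sum:
  assumes "f differentiable (at x)"
  shows "dirderiv f v x = (\<Sum>b\<in>Basis. (v \<bullet> b) *\<^sub>R dirderiv f b x)"
proof -
  interpret linear "\<lambda>v. dirderiv f v x" by (rule linear_dirderiv[OF assms])
  have "dirderiv f v x = dirderiv f (\<Sum>b\<in>Basis. (v \<bullet> b) *\<^sub>R b) x"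
    by (simp add: euclidean_representation)
  then show ?thesis by (simp add: sum scale)
qed

text \<open>Expanded in a basis, the chain rule writes a directional derivative of \<open>f \<circ> \<phi>\<close> as a finite sum of
  products of derivatives of \<open>\<phi>\<close> with derivatives of \<open>f\<close> composed with \<open>\<phi>\<close>; the induction is therefore over the
  order with \<open>f\<close> arbitrary.\<close>

lemma Ck_on_compose:
  assumes "open V" "open U" "\<phi> ` V \<subseteq> U" "Ck_on k V \<phi>" "Ck_on k U f"
  shows "Ck_on k V (f \<circ> \<phi>)"
  using assms(4,5)
proof (induction k arbitrary: f)
  case 0
  then show ?case
    using assms(3) continuous_on_compose[of V \<phi> f] continuous_on_subset[of U f "\<phi> ` V"] by simp
next
  case (Suc k)
  have phi: "\<phi> differentiable (at x)" if "x \<in> V" for x using Suc.prems(1) that by auto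
  have f: "f differentiable (at (\<phi> x))" if "x \<in> V" for x using Suc.prems(2) assms(3) that by auto
  have "Ck_on k V (dirderiv (f \<circ> \<phi>) v)" for v
  proof (rule Ck_on_cong[OF assms(1)])
    show "Ck_on k V (\<lambda>x. \<Sum>b\<in>Basis. (dirderiv \<phi> v x \<bullet> b) *\<^sub>R (dirderiv f b \<circ> \<phi>) x)"
      by (intro Ck_on_sum Ck_on_bilinear[OF _ bounded_bilinear_scaleR] Ck_on_inner Ck_on_const
            assms(1) Suc.IH Ck_on_SucD[OF Suc.prems(1)] Ck_on_dirderiv Suc.prems)
    show "(\<Sum>b\<in>Basis. (dirderiv \<phi> v y \<bullet> b) *\<^sub>R (dirderiv f b \<circ> \<phi>) y) = dirderiv (f \<circ> \<phi>) v y"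
      if "y \<in> V" for y
      unfolding dirderiv_compose(2)[OF phi[OF that] f[OF that]]
      by (subst dirderiv_basis_sum[OF f[OF that]]) simp
  qed
  then show ?case using dirderiv_compose(1)[OF phi f] unfolding Ck_on.simps by blast
qed

lemma Ck_on_vec_nth: "open S \<Longrightarrow> Ck_on k S f \<Longrightarrow> Ck_on k S (\<lambda>x. f x $ i)"
  by (rule Ck_on_bounded_linear[OF _ bounded_linear_vec_nth])

lemma DERIV_along_line:
  fixes g :: "'a::euclidean_space \<Rightarrow> real"
  assumes "g differentiable (at (x + t *\<^sub>R v))"
  shows "((\<lambda>s. g (x + s *\<^sub>R v)) has_real_derivative dirderiv g v (x + t *\<^sub>R v)) (at t)"
proof -
  interpret linear "\<lambda>w. dirderiv g w (x + t *\<^sub>R v)" by (rule linear_dirderiv[OF assms])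
  have "((\<lambda>s. x + s *\<^sub>R v) has_derivative (\<lambda>s. s *\<^sub>R v)) (at t)"
    by (auto intro!: derivative_eq_intros)
  from diff_chain_at[OF this has_derivative_dirderiv[OF assms]]
  have "((\<lambda>s. g (x + s *\<^sub>R v)) has_derivative (\<lambda>s. s * dirderiv g v (x + t *\<^sub>R v))) (at t)"
    by (simp add: o_def scale)
  moreover have "(\<lambda>s. s * dirderiv g v (x + t *\<^sub>R v)) = (*) (dirderiv g v (x + t *\<^sub>R v))"
    by (rule ext) (rule mult.commute)
  ultimately show ?thesis by (simp only: has_field_derivative_def)
qed

text \<open>Two applications of the mean value theorem, first along \<open>v\<close> and then along \<open>w\<close>. The left-hand side is
  symmetric in \<open>v\<close> and \<open>w\<close>, which is the source of the symmetry of second derivatives.\<close>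

lemma mixed_difference_mvt:
  fixes g :: "'a::euclidean_space \<Rightarrow> real"
  assumes g: "Ck_on 2 S g" and S: "ball x r \<subseteq> S" and t: "0 < t" "t * (norm v + norm w) < r"
  shows "\<exists>z \<in> ball x r. g (x + t *\<^sub>R v + t *\<^sub>R w) - g (x + t *\<^sub>R v) - g (x + t *\<^sub>R w) + g x
            = t * (t * dirderiv (dirderiv g v) w z)"
proof -
  have inb: "x + s *\<^sub>R v + u *\<^sub>R w \<in> ball x r" if "0 \<le> s" "s \<le> t" "0 \<le> u" "u \<le> t" for s u
  proof -
    have "norm (s *\<^sub>R v + u *\<^sub>R w) \<le> s * norm v + u * norm w"
      using that norm_triangle_ineq[of "s *\<^sub>R v" "u *\<^sub>R w"] by simp
    also have "\<dots> \<le> t * norm v + t * norm w"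
      using that by (intro add_mono mult_right_mono) auto
    finally have "norm (s *\<^sub>R v + u *\<^sub>R w) < r" using t(2) by (simp add: algebra_simps)
    moreover have "dist x (x + s *\<^sub>R v + u *\<^sub>R w) = norm (s *\<^sub>R v + u *\<^sub>R w)"
      unfolding dist_norm by (subst norm_minus_commute) (simp add: algebra_simps)
    ultimately show ?thesis by simp
  qed
  have inS: "x + s *\<^sub>R v + u *\<^sub>R w \<in> S" if "0 \<le> s" "s \<le> t" "0 \<le> u" "u \<le> t" for s u
    using inb[OF that] S by auto
  have d1: "g differentiable (at z)" if "z \<in> S" for z using g that by (auto simp: numeral_2_eq_2)
  have d2: "dirderiv g v differentiable (at z)" if "z \<in> S" for z
    using g that by (auto simp: numeral_2_eq_2)
  have "\<exists>s. 0 < s \<and> s < t \<and>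
      (g ((x + t *\<^sub>R w) + t *\<^sub>R v) - g (x + t *\<^sub>R v)) - (g ((x + t *\<^sub>R w) + 0 *\<^sub>R v) - g (x + 0 *\<^sub>R v))
      = (t - 0) * (dirderiv g v ((x + t *\<^sub>R w) + s *\<^sub>R v) - dirderiv g v (x + s *\<^sub>R v))"
  proof (rule MVT2[OF t(1)])
    fix s assume "0 \<le> s" "s \<le> t"
    then have a: "(x + t *\<^sub>R w) + s *\<^sub>R v \<in> S" "x + s *\<^sub>R v \<in> S"
      using inS[of s t] inS[of s 0] t(1) by (auto simp: algebra_simps)
    show "((\<lambda>s. g ((x + t *\<^sub>R w) + s *\<^sub>R v) - g (x + s *\<^sub>R v)) has_real_derivative
        dirderiv g v ((x + t *\<^sub>R w) + s *\<^sub>R v) - dirderiv g v (x + s *\<^sub>R v)) (at s)"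
      by (intro DERIV_diff DERIV_along_line d1 a)
  qed
  then obtain s where s: "0 < s" "s < t" and
    e1: "g (x + t *\<^sub>R v + t *\<^sub>R w) - g (x + t *\<^sub>R v) - g (x + t *\<^sub>R w) + g x
      = t * (dirderiv g v ((x + s *\<^sub>R v) + t *\<^sub>R w) - dirderiv g v ((x + s *\<^sub>R v) + 0 *\<^sub>R w))"
    by (auto simp: algebra_simps)
  have "\<exists>u. 0 < u \<and> u < t \<and>
     dirderiv g v ((x + s *\<^sub>R v) + t *\<^sub>R w) - dirderiv g v ((x + s *\<^sub>R v) + 0 *\<^sub>R w)
     = (t - 0) * dirderiv (dirderiv g v) w ((x + s *\<^sub>R v) + u *\<^sub>R w)"
    by (rule MVT2[OF t(1)], rule DERIV_along_line, rule d2) (use inS s in auto)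
  then obtain u where u: "0 < u" "u < t" and
    e2: "dirderiv g v ((x + s *\<^sub>R v) + t *\<^sub>R w) - dirderiv g v ((x + s *\<^sub>R v) + 0 *\<^sub>R w)
     = t * dirderiv (dirderiv g v) w ((x + s *\<^sub>R v) + u *\<^sub>R w)"
    by auto
  show ?thesis
    by (rule bexI[of _ "(x + s *\<^sub>R v) + u *\<^sub>R w"]) (use e1 e2 inb[of s u] s u in auto)
qed

text \<open>The same second difference at a small scale is a value of either mixed derivative near \<open>x\<close>. By
  continuity the two mixed derivatives cannot differ at \<open>x\<close>.\<close>

lemma symmetric_dirderiv_real:
  fixes g :: "'a::euclidean_space \<Rightarrow> real"
  assumes "open S" "Ck_on 2 S g" "x \<in> S"
  shows "dirderiv (dirderiv g v) w x = dirderiv (dirderiv g w) v x"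
proof (rule ccontr)
  let ?a = "dirderiv (dirderiv g v) w" and ?b = "dirderiv (dirderiv g w) v"
  assume ne: "?a x \<noteq> ?b x"
  define e where "e = \<bar>?a x - ?b x\<bar> / 2"
  have e: "e > 0" using ne by (simp add: e_def)
  have "continuous_on S ?a" "continuous_on S ?b" using assms(2) by (auto simp: numeral_2_eq_2)
  then have "isCont ?a x" "isCont ?b x"
    using assms(1,3) continuous_on_eq_continuous_at by blast+
  then obtain r1 r2 where r12: "r1 > 0" "r2 > 0" "\<forall>z. dist z x < r1 \<longrightarrow> dist (?a z) (?a x) < e"
     "\<forall>z. dist z x < r2 \<longrightarrow> dist (?b z) (?b x) < e"
    unfolding continuous_at_eps_delta using e by metis
  obtain r3 where r3: "r3 > 0" "ball x r3 \<subseteq> S" using assms(1,3) open_contains_ball by blast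
  define r where "r = min r1 (min r2 r3)"
  have r: "r > 0" "ball x r \<subseteq> S" using r12 r3 by (auto simp: r_def)
  \<comment> \<open>small enough for both mean value points to stay in the ball\<close>
  define t where "t = r / (norm v + norm w + 1)"
  have t: "0 < t" "t * (norm v + norm w) < r"
    using r by (auto simp: t_def field_simps add_pos_nonneg)
  obtain z1 where z1: "z1 \<in> ball x r" "g (x + t *\<^sub>R v + t *\<^sub>R w) - g (x + t *\<^sub>R v) - g (x + t *\<^sub>R w) + g x
            = t * (t * ?a z1)"
    using mixed_difference_mvt[OF assms(2) r(2) t] by blast
  obtain z2 where z2: "z2 \<in> ball x r" "g (x + t *\<^sub>R w + t *\<^sub>R v) - g (x + t *\<^sub>R w) - g (x + t *\<^sub>R v) + g x
            = t * (t * ?b z2)"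
    using mixed_difference_mvt[OF assms(2) r(2), of t w v] t by (auto simp: add.commute)
  have "?a z1 = ?b z2" using z1(2) z2(2) t(1) by (simp add: algebra_simps)
  moreover have "dist (?a z1) (?a x) < e"
    by (rule r12(3)[rule_format]) (use z1(1) in \<open>simp add: r_def dist_commute[of x]\<close>)
  moreover have "dist (?b z2) (?b x) < e"
    by (rule r12(4)[rule_format]) (use z2(1) in \<open>simp add: r_def dist_commute[of x]\<close>)
  ultimately show False unfolding e_def dist_real_def by argo
qed

lemma symmetric_dirderiv:
  fixes h :: "'a::euclidean_space \<Rightarrow> 'b::euclidean_space"
  assumes "open S" "Ck_on 2 S h" "x \<in> S"
  shows "dirderiv (dirderiv h v) w x = dirderiv (dirderiv h w) v x"
proof (rule euclidean_eqI)
  fix b :: 'b assume "b \<in> Basis"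
  let ?g = "\<lambda>y. h y \<bullet> b"
  have bl: "bounded_linear (\<lambda>z::'b. z \<bullet> b)" by (rule bounded_linear_inner_left)
  have d: "h differentiable (at y)" "dirderiv h v differentiable (at y)" if "y \<in> S" for y v
    using assms(2) that by (auto simp: numeral_2_eq_2)
  have 2: "dirderiv (dirderiv ?g v) w x = dirderiv (dirderiv h v) w x \<bullet> b" for v w
  proof -
    have "dirderiv (\<lambda>y. dirderiv h v y \<bullet> b) w x = dirderiv (dirderiv h v) w x \<bullet> b"
      by (rule dirderiv_bounded_linear(2)[OF bl d(2)[OF assms(3)]])
    moreover have "dirderiv (dirderiv ?g v) w x = dirderiv (\<lambda>y. dirderiv h v y \<bullet> b) w x"
      by (rule dirderiv_cong_open(2)[OF assms(1,3)])
         (use dirderiv_bounded_linear(2)[OF bl d(1)] dirderiv_bounded_linear(1)[OF bl d(2)[OF assms(3)]] in auto)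
    ultimately show ?thesis by simp
  qed
  show "dirderiv (dirderiv h v) w x \<bullet> b = dirderiv (dirderiv h w) v x \<bullet> b"
    using symmetric_dirderiv_real[OF assms(1) Ck_on_bounded_linear[OF assms(1) bl assms(2)] assms(3), of v w]
    by (simp add: 2)
qed

text \<open>A derivative of \<open>f\<close> in a direction \<open>Z\<close> that varies with the point. Only constant directions are
  covered by the second derivative directly, so \<open>Z\<close> is expanded in a basis; symmetry of second derivatives collects
  the terms again.\<close>

lemma dirderiv_field_along:
  fixes f :: "'b::euclidean_space \<Rightarrow> 'c::euclidean_space" and \<phi> Z :: "'a::euclidean_space \<Rightarrow> 'b"
  assumes "open U" "Ck_on 2 U f" "\<phi> x \<in> U" "open V" "x \<in> V" "\<phi> ` V \<subseteq> U"
    and \<phi>: "\<phi> differentiable (at x)" and Z: "Z differentiable (at x)"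
  shows "(\<lambda>y. dirderiv f (Z y) (\<phi> y)) differentiable (at x)"
    "dirderiv (\<lambda>y. dirderiv f (Z y) (\<phi> y)) u x
      = dirderiv f (dirderiv Z u x) (\<phi> x) + dirderiv (dirderiv f (Z x)) (dirderiv \<phi> u x) (\<phi> x)"
proof -
  have d1: "f differentiable (at z)" "dirderiv f v differentiable (at z)" if "z \<in> U" for z v
    using assms(2) that by (auto simp: numeral_2_eq_2)
  let ?S = "\<lambda>y. \<Sum>b\<in>Basis. (Z y \<bullet> b) *\<^sub>R (dirderiv f b \<circ> \<phi>) y"
  have Zb: "((\<lambda>y. Z y \<bullet> b) has_derivative (\<lambda>u. dirderiv Z u x \<bullet> b)) (at x)" for b
    by (rule bounded_linear.has_derivative[OF bounded_linear_inner_left has_derivative_dirderiv[OF Z]])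
  have fb: "((dirderiv f b \<circ> \<phi>) has_derivative (\<lambda>u. dirderiv (dirderiv f b) (dirderiv \<phi> u x) (\<phi> x))) (at x)" for b
    using diff_chain_at[OF has_derivative_dirderiv[OF \<phi>] has_derivative_dirderiv[OF d1(2)[OF assms(3)]]]
    by (simp only: o_def)
  have S: "(?S has_derivative (\<lambda>u. \<Sum>b\<in>Basis. (Z x \<bullet> b) *\<^sub>R dirderiv (dirderiv f b) (dirderiv \<phi> u x) (\<phi> x)
        + (dirderiv Z u x \<bullet> b) *\<^sub>R (dirderiv f b \<circ> \<phi>) x)) (at x)"
    by (intro has_derivative_sum has_derivative_scaleR Zb fb)
  have eq: "?S y = dirderiv f (Z y) (\<phi> y)" if "y \<in> V" for y
    using dirderiv_basis_sum[OF d1(1), of "\<phi> y" "Z y"] assms(6) that by auto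
  have D: "((\<lambda>y. dirderiv f (Z y) (\<phi> y)) has_derivative
      (\<lambda>u. \<Sum>b\<in>Basis. (Z x \<bullet> b) *\<^sub>R dirderiv (dirderiv f b) (dirderiv \<phi> u x) (\<phi> x)
        + (dirderiv Z u x \<bullet> b) *\<^sub>R (dirderiv f b \<circ> \<phi>) x)) (at x)"
    by (rule has_derivative_transform_within_open[OF S assms(4,5) eq])
  show "(\<lambda>y. dirderiv f (Z y) (\<phi> y)) differentiable (at x)"
    using D by (auto simp: differentiable_def)
  let ?p = "\<phi> x" and ?w = "dirderiv \<phi> u x"
  have sym: "dirderiv (dirderiv f a) b ?p = dirderiv (dirderiv f b) a ?p" for a b
    by (rule symmetric_dirderiv[OF assms(1,2,3)])
  have "(\<Sum>b\<in>Basis. (Z x \<bullet> b) *\<^sub>R dirderiv (dirderiv f b) ?w ?p) = dirderiv (dirderiv f (Z x)) ?w ?p"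
    unfolding sym[of _ ?w] by (rule dirderiv_basis_sum[OF d1(2)[OF assms(3)], symmetric])
  moreover have "(\<Sum>b\<in>Basis. (dirderiv Z u x \<bullet> b) *\<^sub>R dirderiv f b ?p) = dirderiv f (dirderiv Z u x) ?p"
    by (rule dirderiv_basis_sum[OF d1(1)[OF assms(3)], symmetric])
  ultimately show "dirderiv (\<lambda>y. dirderiv f (Z y) (\<phi> y)) u x
      = dirderiv f (dirderiv Z u x) (\<phi> x) + dirderiv (dirderiv f (Z x)) (dirderiv \<phi> u x) (\<phi> x)"
    by (simp only: dirderiv_eqI[OF D] sum.distrib o_def add.commute)
qed

lemma dirderiv_field:
  fixes f :: "'b::euclidean_space \<Rightarrow> 'c::euclidean_space"
  assumes "open U" "Ck_on 2 U f" "x \<in> U" and "Z differentiable (at x)"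
  shows "(\<lambda>y. dirderiv f (Z y) y) differentiable (at x)"
    "dirderiv (\<lambda>y. dirderiv f (Z y) y) u x = dirderiv f (dirderiv Z u x) x + dirderiv (dirderiv f (Z x)) u x"
  using dirderiv_field_along[where \<phi>="\<lambda>y. y", OF assms(1,2,3,1,3) _ _ assms(4)] by auto

lemma tendsto_along_line:
  fixes x v :: "'a::real_normed_vector"
  assumes "isCont G x"
  shows "((\<lambda>t::real. G (x + t *\<^sub>R v)) \<longlongrightarrow> G x) (at 0)"
proof (rule isCont_tendsto_compose[OF assms])
  have "((\<lambda>t::real. x + t *\<^sub>R v) \<longlongrightarrow> x + 0 *\<^sub>R v) (at 0)"
    by (intro tendsto_add tendsto_scaleR tendsto_const tendsto_ident_at)
  then show "((\<lambda>t::real. x + t *\<^sub>R v) \<longlongrightarrow> x) (at 0)" by simp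
qed

lemma eventually_along_line:
  fixes x v :: "'a::real_normed_vector"
  assumes "open S" "x \<in> S"
  shows "eventually (\<lambda>t::real. x + t *\<^sub>R v \<in> S) (at 0)"
  using topological_tendstoD[OF tendsto_along_line[where G="\<lambda>z. z" and x=x and v=v] assms] by simp

lemma difference_quotient_along_line:
  fixes G :: "'a::euclidean_space \<Rightarrow> 'b::euclidean_space"
  assumes "G differentiable (at x)"
  shows "((\<lambda>t. (1 / t) *\<^sub>R (G (x + t *\<^sub>R v) - G x)) \<longlongrightarrow> dirderiv G v x) (at 0)"
proof (subst tendsto_componentwise_iff, rule ballI)
  fix b :: 'b assume "b \<in> Basis"
  note bl = dirderiv_bounded_linear[OF bounded_linear_inner_left[of b] assms]
  have "((\<lambda>s. G (x + s *\<^sub>R v) \<bullet> b) has_real_derivative dirderiv G v x \<bullet> b) (at 0)"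
    using DERIV_along_line[of "\<lambda>y. G y \<bullet> b" x 0 v] bl by simp
  then show "((\<lambda>t. (1 / t) *\<^sub>R (G (x + t *\<^sub>R v) - G x) \<bullet> b) \<longlongrightarrow> dirderiv G v x \<bullet> b) (at 0)"
    by (simp add: DERIV_def inner_diff_left)
qed

section \<open>Determinants, Gram matrices and quadratic forms\<close>

definition gram_matrix :: "(real ^ 'n \<Rightarrow> 'b::real_inner) \<Rightarrow> real ^ 'n ^ 'n" where
  "gram_matrix T = (\<chi> i j. T (axis j 1) \<bullet> T (axis i 1))"

lemma gram_matrix_mult:
  assumes "linear T"
  shows "(gram_matrix T *v z) $ i = T z \<bullet> T (axis i 1)"
proof -
  interpret linear T by fact
  have "T z = T (\<Sum>j\<in>UNIV. (z $ j) *\<^sub>R axis j 1)"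
    using basis_expansion[of z] by (simp add: scalar_mult_eq_scaleR)
  then show ?thesis
    by (simp add: gram_matrix_def matrix_vector_mult_def sum scale inner_sum_left mult.commute)
qed

lemma linear_functional_eqI_axis:
  fixes l :: "real ^ 'n \<Rightarrow> real"
  assumes "linear l" "linear l'" "\<And>i. l (axis i 1) = l' (axis i 1)"
  shows "l = l'"
  by (rule linear_eq_stdbasis[OF assms(1,2)]) (use assms(3) in \<open>auto simp: Basis_vec_def\<close>)

lemma det_gram_matrix_nonzero:
  assumes "linear T" "inj T"
  shows "det (gram_matrix T) \<noteq> 0"
proof -
  interpret linear T by fact
  have "z = 0" if "gram_matrix T *v z = 0" for z
  proof -
    have l: "(\<lambda>u. T z \<bullet> T u) = (\<lambda>u. 0)"
      by (rule linear_functional_eqI_axis)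
         (use that gram_matrix_mult[OF assms(1), of z] in
           \<open>auto simp: linear_iff add scale inner_add_right vec_eq_iff\<close>)
    have "T z \<bullet> T z = 0" using fun_cong[OF l, of z] .
    then show "z = 0" using injD[OF assms(2), of z 0] zero by simp
  qed
  then have "invertible (gram_matrix T)"
    using invertible_left_inverse matrix_left_invertible_ker by blast
  then show ?thesis by (simp add: invertible_det_nz)
qed

text \<open>A linear functional is represented through an injective map by solving the Gram system. Cramer's rule is
  used in preference to an abstract inverse because it displays the solution as a rational expression in the data,
  from which differentiability in a parameter can be read off.\<close>

lemma gram_representation:
  fixes T :: "real ^ 'n \<Rightarrow> 'b::real_inner"
  assumes "linear T" "inj T" "linear l"
  defines "z \<equiv> \<chi> k. det (\<chi> i j. if j = k then l (axis i 1) else gram_matrix T $ i $ j) / det (gram_matrix T)"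
  shows "(\<forall>u. T z' \<bullet> T u = l u) \<longleftrightarrow> z' = z"
proof -
  interpret linear T by fact
  have "(\<forall>u. T z' \<bullet> T u = l u) \<longleftrightarrow> (\<forall>i. T z' \<bullet> T (axis i 1) = l (axis i 1))"
  proof (intro iffI allI)
    fix u assume a: "\<forall>i. T z' \<bullet> T (axis i 1) = l (axis i 1)"
    have "(\<lambda>u. T z' \<bullet> T u) = l"
      by (rule linear_functional_eqI_axis[OF _ assms(3)])
         (use a in \<open>auto simp: linear_iff add scale inner_add_right\<close>)
    then show "T z' \<bullet> T u = l u" by meson
  qed auto
  also have "\<dots> \<longleftrightarrow> gram_matrix T *v z' = (\<chi> i. l (axis i 1))"
    by (simp add: vec_eq_iff gram_matrix_mult[OF assms(1)])
  also have "\<dots> \<longleftrightarrow> z' = z"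
    by (subst cramer[OF det_gram_matrix_nonzero[OF assms(1,2)]]) (simp add: z_def cong: if_cong)
  finally show ?thesis .
qed

text \<open>The matrix whose determinant is the signed density, with an arbitrary linear map and vector in the
  place of \<open>df\<close> and \<open>\<nu>\<close>.\<close>

definition frame_matrix :: "(real ^ 'm \<Rightarrow> real ^ 'm option) \<Rightarrow> real ^ 'm option \<Rightarrow> real ^ 'm option ^ 'm option" where
  "frame_matrix T n = (\<chi> i j. case j of Some k \<Rightarrow> T (axis k 1) $ i | None \<Rightarrow> n $ i)"

lemma sum_option_univ:
  fixes F :: "'m::finite option \<Rightarrow> 'b::comm_monoid_add"
  shows "sum F UNIV = F None + (\<Sum>k\<in>UNIV. F (Some k))"
proof -
  have "sum F UNIV = F None + sum F (range Some)"
    unfolding UNIV_option_conv by (subst sum.insert) auto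
  then show ?thesis by (simp add: sum.reindex)
qed

lemma frame_matrix_mult:
  assumes "linear T"
  shows "frame_matrix T n *v c = T (\<chi> k. c $ Some k) + (c $ None) *\<^sub>R n"
proof -
  interpret linear T by fact
  have "T (\<chi> k. c $ Some k) = T (\<Sum>k\<in>UNIV. (c $ Some k) *\<^sub>R axis k 1)"
    using basis_expansion[of "\<chi> k. c $ Some k"] by (simp add: scalar_mult_eq_scaleR)
  then show ?thesis
    by (simp add: vec_eq_iff frame_matrix_def matrix_vector_mult_def sum_option_univ sum scale mult.commute)
qed

lemma det_nonzero_kernel:
  fixes M :: "real ^ 'n ^ 'n"
  assumes "det M \<noteq> 0" "M *v c = 0"
  shows "c = 0"
proof -
  have "invertible M" using assms(1) invertible_det_nz by blast
  then show ?thesis using assms(2) invertible_left_inverse matrix_left_invertible_ker by blast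
qed

text \<open>A vector orthogonal to all columns of \<open>M\<close> lies in the kernel of the transpose.\<close>

lemma det_nonzero_orthogonal_columns:
  fixes M :: "real ^ 'n ^ 'n"
  assumes "det M \<noteq> 0" "\<And>j. (\<Sum>i\<in>UNIV. q $ i * M $ i $ j) = 0"
  shows "q = 0"
proof (rule det_nonzero_kernel)
  show "det (transpose M) \<noteq> 0" using assms(1) by (simp add: det_transpose)
  show "transpose M *v q = 0"
    using assms(2) by (simp add: vec_eq_iff matrix_vector_mult_def transpose_def mult.commute)
qed

lemma det_column_scale:
  fixes M :: "real ^ 'n ^ 'n"
  shows "det (\<chi> i j. if j = k then c * (v $ i) else M $ i $ j)
    = c * det (\<chi> i j. if j = k then v $ i else M $ i $ j)"
proof -
  have "transpose (\<chi> i j. if j = k then c * (v $ i) else M $ i $ j)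
      = (\<chi> j. if j = k then c *s v else transpose M $ j)"
    by (simp add: vec_eq_iff transpose_def)
  moreover have "transpose (\<chi> i j. if j = k then v $ i else M $ i $ j)
      = (\<chi> j. if j = k then v else transpose M $ j)"
    by (simp add: vec_eq_iff transpose_def)
  ultimately show ?thesis
    using det_row_mul[of k c "\<lambda>_. v" "\<lambda>j. transpose M $ j"]
    by (subst (1 2) det_transpose[symmetric]) simp
qed

lemma tendsto_det:
  fixes M :: "'t \<Rightarrow> real ^ 'n ^ 'n"
  assumes "\<And>i j. ((\<lambda>t. M t $ i $ j) \<longlongrightarrow> M0 $ i $ j) F"
  shows "((\<lambda>t. det (M t)) \<longlongrightarrow> det M0) F"
  unfolding det_def by (intro tendsto_sum tendsto_mult tendsto_const tendsto_prod assms)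

text \<open>Completing the square: the form at the vertex \<open>v - (P v w / P w w) w\<close> is the discriminant divided
  by \<open>P w w\<close>. In the semidefinite case with \<open>P w w = 0\<close> the form is affine along \<open>w\<close> and bounded below, hence
  constant there.\<close>

lemma quadratic_form_discriminant:
  fixes P :: "'a::real_vector \<Rightarrow> 'a \<Rightarrow> real"
  assumes add: "\<And>a b c. P (a + b) c = P a c + P b c" and scale: "\<And>r a b. P (r *\<^sub>R a) b = r * P a b"
    and sym: "\<And>a b. P a b = P b a"
  shows "(\<And>b. P b b \<ge> 0) \<Longrightarrow> (P v w)\<^sup>2 \<le> P v v * P w w"
    and "\<lbrakk>\<And>b. b \<noteq> 0 \<Longrightarrow> P b b > 0; v \<noteq> w; independent {v, w}\<rbrakk> \<Longrightarrow> (P v w)\<^sup>2 < P v v * P w w"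
proof -
  have addr: "P c (a + b) = P c a + P c b" for a b c
    using add[of a b c] sym[of "a + b" c] sym[of a c] sym[of b c] by linarith
  have scaler: "P a (r *\<^sub>R b) = r * P a b" for r a b
    using scale[of r b a] sym[of "r *\<^sub>R b" a] sym[of b a] by simp
  have expand: "P (v + s *\<^sub>R w) (v + s *\<^sub>R w) = P v v + 2 * s * P v w + s\<^sup>2 * P w w" for s
    by (simp add: add scale addr scaler sym[of w v] algebra_simps power2_eq_square)
  have vertex: "P w w * P (v + (- P v w / P w w) *\<^sub>R w) (v + (- P v w / P w w) *\<^sub>R w)
      = P v v * P w w - (P v w)\<^sup>2" if "P w w \<noteq> 0"
    unfolding expand using that by (simp add: field_simps power2_eq_square)
  show "(P v w)\<^sup>2 \<le> P v v * P w w" if nn: "\<And>b. P b b \<ge> 0"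
  proof (cases "P w w = 0")
    case True
    have "P v w = 0"
    proof (rule ccontr)
      assume ne: "P v w \<noteq> 0"
      \<comment> \<open>the parameter at which the affine function takes the value \<open>-1\<close>\<close>
      have "0 \<le> P v v + 2 * (- (P v v + 1) / (2 * P v w)) * P v w"
        using nn[of "v + (- (P v v + 1) / (2 * P v w)) *\<^sub>R w"] unfolding expand True by simp
      then show False using ne by (simp add: field_simps)
    qed
    then show ?thesis using True by simp
  next
    case False
    then show ?thesis using vertex nn[of w] nn[of "v + (- P v w / P w w) *\<^sub>R w"]
      by (metis diff_ge_0_iff_ge mult_nonneg_nonneg)
  qed
  show "(P v w)\<^sup>2 < P v v * P w w"
    if pd: "\<And>b. b \<noteq> 0 \<Longrightarrow> P b b > 0" and ne: "v \<noteq> w" and ind: "independent {v, w}"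
  proof -
    have w0: "w \<noteq> 0" using ind dependent_zero by auto
    have "v + s *\<^sub>R w \<noteq> 0" for s
    proof
      assume "v + s *\<^sub>R w = 0"
      then have "v = (- s) *\<^sub>R w" by (simp add: eq_neg_iff_add_eq_0)
      then have "v \<in> span {w}" by (metis span_base span_scale insertI1)
      moreover have "{v, w} - {v} = {w}" using ne by auto
      ultimately show False using ind unfolding dependent_def by auto
    qed
    then show ?thesis using vertex pd[of w] pd[of "v + (- P v w / P w w) *\<^sub>R w"] w0
      by (metis diff_gt_0_iff_gt less_irrefl mult_pos_pos)
  qed
qed

lemma independent_pair:
  fixes v w :: "'a::real_vector"
  assumes "v \<noteq> 0" "\<And>s. w \<noteq> s *\<^sub>R v"
  shows "v \<noteq> w" "independent {v, w}"
proof -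
  show ne: "v \<noteq> w" using assms(2)[of 1] by auto
  have "w \<notin> span {v}" using assms(2) by (auto simp: span_singleton)
  then have "independent {w, v}" using assms(1) by (simp add: independent_insert)
  then show "independent {v, w}" by (simp add: insert_commute)
qed

lemma gram_determinant_pos:
  fixes T :: "'a::real_vector \<Rightarrow> 'b::real_inner"
  assumes "linear T" "inj T" "v \<noteq> w" "independent {v, w}"
  shows "(T v \<bullet> T w)\<^sup>2 < (T v \<bullet> T v) * (T w \<bullet> T w)"
proof -
  interpret linear T by fact
  have "T b \<noteq> 0" if "b \<noteq> 0" for b using that assms(2) unfolding inj_iff_eq_0 by blast
  then have pos: "0 < T b \<bullet> T b" if "b \<noteq> 0" for b using that by simp
  show ?thesis
    by (rule quadratic_form_discriminant(2)[where P="\<lambda>a b. T a \<bullet> T b", OF _ _ _ pos assms(3,4)])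
       (simp add: add inner_add_left, simp add: scale, rule inner_commute, assumption)
qed

text \<open>By dimension the range of \<open>T\<close> is a hyperplane.\<close>

lemma hyperplane_complement:
  fixes T :: "real ^ 'k \<Rightarrow> real ^ 'm"
  assumes "linear T" "inj T" "CARD('k) + 1 = CARD('m)" "\<eta> \<notin> range T"
  shows "\<exists>b s. a = T b + s *\<^sub>R \<eta>"
proof -
  have sub: "subspace (range T)" using linear_subspace_image[OF assms(1) subspace_UNIV] .
  then have sp: "span (range T) = range T" using span_eq_iff by blast
  then have "\<eta> \<notin> span (range T)" using assms(4) by blast
  then have "dim (insert \<eta> (range T)) = dim (range T) + 1" by (simp add: dim_insert)
  also have "dim (range T) = CARD('k)"
    using dim_image_eq[OF assms(1), of UNIV] assms(2) by simp
  finally have "span (insert \<eta> (range T)) = UNIV" using assms(3) by (simp add: dim_eq_full[symmetric])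
  then have "a \<in> span (insert \<eta> (range T))" by simp
  then obtain s where "a - s *\<^sub>R \<eta> \<in> range T"
    using span_breakdown_eq[of a \<eta> "range T"] unfolding sp by blast
  then obtain b where "a - s *\<^sub>R \<eta> = T b" by blast
  then have "a = T b + s *\<^sub>R \<eta>" by (simp add: algebra_simps)
  then show ?thesis by blast
qed

section \<open>The Gauss equation for an immersion\<close>

text \<open>Expanding the derivatives of the inner products and using the symmetry of second derivatives, all terms
  but two cancel. So the Christoffel vector of an induced metric is the preimage under \<open>dh\<close> of the tangential part of
  \<open>D\<^sub>v D\<^sub>w h\<close>.\<close>

lemma koszul_induced_metric:
  fixes h :: "real ^ 'n \<Rightarrow> 'b::euclidean_space"
  assumes "open S" "Ck_on 2 S h" "x \<in> S"
  shows "dirderiv (\<lambda>y. induced_metric h y w u) v x + dirderiv (\<lambda>y. induced_metric h y v u) w x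
    - dirderiv (\<lambda>y. induced_metric h y v w) u x = 2 * (dirderiv (dirderiv h w) v x \<bullet> dirderiv h u x)"
proof -
  have d: "dirderiv h v differentiable (at x)" for v using assms by (auto simp: numeral_2_eq_2)
  have sym: "dirderiv (dirderiv h a) b x = dirderiv (dirderiv h b) a x" for a b
    by (rule symmetric_dirderiv[OF assms])
  show ?thesis
    unfolding induced_metric_def dirderiv_inner(2)[OF d d]
    by (simp add: sym[of u v] sym[of v w] sym[of u w] inner_commute)
qed

lemma christoffel_induced:
  fixes h :: "real ^ 'n \<Rightarrow> 'b::euclidean_space"
  assumes "open S" "Ck_on 2 S h" "x \<in> S" "inj (frechet_derivative h (at x))"
  shows "christoffel (induced_metric h) x v w = (\<chi> k.
     det (\<chi> i j. if j = k then dirderiv (dirderiv h w) v x \<bullet> dirderiv h (axis i 1) x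
          else gram_matrix (\<lambda>u. dirderiv h u x) $ i $ j) / det (gram_matrix (\<lambda>u. dirderiv h u x)))" (is "_ = ?z")
   and "dirderiv h (christoffel (induced_metric h) x v w) x \<bullet> dirderiv h u x
      = dirderiv (dirderiv h w) v x \<bullet> dirderiv h u x"
proof -
  have "h differentiable (at x)" using assms(2,3) by (auto simp: numeral_2_eq_2)
  note lin = linear_dirderiv[OF this]
  have inj: "inj (\<lambda>u. dirderiv h u x)" using assms(4) by simp
  have l: "linear (\<lambda>u. dirderiv (dirderiv h w) v x \<bullet> dirderiv h u x)"
    using lin by (auto simp: linear_iff inner_add_right)
  note iff = gram_representation[OF lin inj l]
  have "christoffel (induced_metric h) x v w
      = (THE z. \<forall>u. dirderiv h z x \<bullet> dirderiv h u x = dirderiv (dirderiv h w) v x \<bullet> dirderiv h u x)"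
    unfolding christoffel_def koszul_induced_metric[OF assms(1-3)] by (simp add: induced_metric_def)
  also have "\<dots> = ?z" unfolding iff by simp
  finally show eq: "christoffel (induced_metric h) x v w = ?z" .
  show "dirderiv h (christoffel (induced_metric h) x v w) x \<bullet> dirderiv h u x
      = dirderiv (dirderiv h w) v x \<bullet> dirderiv h u x"
    using iff[of "christoffel (induced_metric h) x v w"] eq by blast
qed

lemma Ck_on_gram_matrix:
  fixes h :: "real ^ 'n \<Rightarrow> 'b::euclidean_space"
  assumes "open S" "Ck_on (Suc k) S h"
  shows "Ck_on k S (\<lambda>y. gram_matrix (\<lambda>u. dirderiv h u y) $ i $ j)"
  unfolding gram_matrix_def using assms by (auto intro!: Ck_on_inner)

lemma christoffel_differentiable:
  fixes h :: "real ^ 'n \<Rightarrow> 'b::euclidean_space"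
  assumes "open S" "Ck_on 3 S h" "\<And>y. y \<in> S \<Longrightarrow> inj (frechet_derivative h (at y))" "x \<in> S"
  shows "(\<lambda>y. christoffel (induced_metric h) y v w) differentiable (at x)"
proof -
  let ?G = "\<lambda>y. gram_matrix (\<lambda>u. dirderiv h u y)"
  let ?N = "\<lambda>k y. (\<chi> i j. if j = k then dirderiv (dirderiv h w) v y \<bullet> dirderiv h (axis i 1) y
          else ?G y $ i $ j) :: real ^ 'n ^ 'n"
  have h3: "Ck_on (Suc 1) S h" "Ck_on (Suc (Suc 1)) S h" "Ck_on 2 S h"
    using Ck_on_le[OF assms(2)] by (auto simp: numeral_2_eq_2 numeral_3_eq_3 simp del: Ck_on.simps)
  have G: "Ck_on 1 S (\<lambda>y. ?G y $ i $ j)" for i j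
    using Ck_on_gram_matrix[OF assms(1) h3(1)] by simp
  have c: "Ck_on 1 S (\<lambda>y. dirderiv (dirderiv h w) v y \<bullet> dirderiv h (axis i 1) y)" for i
    by (intro Ck_on_inner assms(1) Ck_on_dirderiv h3)
  have "Ck_on 1 S (\<lambda>y. ?N k y $ i $ j)" for k i j
    using G c by (cases "j = k") (simp_all del: Ck_on.simps)
  then have dN: "(\<lambda>y. det (?N k y)) differentiable (at x)" for k
    using Ck_on_det[OF assms(1), of 1 "?N k"] assms(4) by simp
  have dG: "(\<lambda>y. det (?G y)) differentiable (at x)"
    using Ck_on_det[OF assms(1), of 1 ?G] G assms(4) by simp
  have nz: "det (?G y) \<noteq> 0" if "y \<in> S" for y
    using that assms(3) h3(3) by (intro det_gram_matrix_nonzero linear_dirderiv) (auto simp: numeral_2_eq_2)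
  have "(\<lambda>y. \<Sum>k\<in>UNIV. (det (?N k y) / det (?G y)) *\<^sub>R axis k 1) differentiable (at x)"
    by (intro differentiable_sum finite ballI differentiable_scaleR differentiable_divide dN dG
         differentiable_const nz assms(4))
  moreover have "(\<Sum>k\<in>UNIV. (det (?N k y) / det (?G y)) *\<^sub>R axis k 1)
      = christoffel (induced_metric h) y v w" if "y \<in> S" for y
    unfolding christoffel_induced(1)[OF assms(1) h3(3) that assms(3)[OF that]]
    using basis_expansion[of "\<chi> k. det (?N k y) / det (?G y)"] by (simp add: scalar_mult_eq_scaleR)
  ultimately show ?thesis
    by (rule dirderiv_cong_open(1)[OF assms(1,4), rotated])
qed

text \<open>Here \<open>q v w\<close> is the normal part of \<open>D\<^sub>v D\<^sub>w h\<close>. Differentiating the identity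
  \<open>\<langle>dh (\<Gamma>(v,w)), dh a\<rangle> = \<langle>D\<^sub>v D\<^sub>w h, dh a\<rangle>\<close> along \<open>u\<close> expresses the covariant derivative of \<open>\<Gamma>(v,w)\<close> as a third
  derivative of \<open>h\<close>, symmetric in \<open>u\<close> and \<open>v\<close>, plus \<open>\<langle>q v w, q u a\<rangle>\<close>. In the curvature the third derivatives cancel and
  only the products of normal parts remain.\<close>

lemma gauss_equation:
  fixes h :: "real ^ 'n \<Rightarrow> 'b::euclidean_space"
  assumes "open S" "Ck_on 3 S h" "\<And>y. y \<in> S \<Longrightarrow> inj (frechet_derivative h (at y))" "x \<in> S"
  defines "g \<equiv> induced_metric h"
  defines "q \<equiv> \<lambda>v w. dirderiv (dirderiv h w) v x - dirderiv h (christoffel g x v w) x"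
  shows "q v w \<bullet> dirderiv h u x = 0"
    and "g x (riemann_curvature g x v w w) v = q v v \<bullet> q w w - q v w \<bullet> q v w"
proof -
  have h2: "Ck_on 2 S h" using Ck_on_le[OF assms(2)] by simp
  have hv2: "Ck_on 2 S (dirderiv h v)" for v
    using assms(2) by (simp add: numeral_2_eq_2 numeral_3_eq_3)
  have d1: "h differentiable (at x)" "dirderiv h v differentiable (at x)"
      "dirderiv (dirderiv h v) w differentiable (at x)" for v w
    using assms(2,4) by (auto simp: numeral_3_eq_3)
  interpret linear "\<lambda>v. dirderiv h v x" by (rule linear_dirderiv[OF d1(1)])
  define \<Gamma> where "\<Gamma> = christoffel g x"
  define d\<Gamma> where "d\<Gamma> = (\<lambda>u v w. dirderiv (\<lambda>y. christoffel g y v w) u x)"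
  have \<Gamma>: "dirderiv h (christoffel g y v w) y \<bullet> dirderiv h u y
      = dirderiv (dirderiv h w) v y \<bullet> dirderiv h u y" if "y \<in> S" for y v w u
    unfolding g_def by (rule christoffel_induced(2)[OF assms(1) h2 that assms(3)[OF that]])
  have sym: "dirderiv (dirderiv h a) b x = dirderiv (dirderiv h b) a x" for a b
    by (rule symmetric_dirderiv[OF assms(1) h2 assms(4)])
  have sym3: "dirderiv (dirderiv (dirderiv h w) a) b x = dirderiv (dirderiv (dirderiv h w) b) a x" for a b w
    by (rule symmetric_dirderiv[OF assms(1) hv2 assms(4)])
  have orth: "q v w \<bullet> dirderiv h u x = 0" for v w u
    unfolding q_def using \<Gamma>[OF assms(4)] by (simp add: inner_diff_left)
  show "q v w \<bullet> dirderiv h u x = 0" by (rule orth)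
  have cd: "(\<lambda>y. christoffel g y v w) differentiable (at x)" for v w
    unfolding g_def by (rule christoffel_differentiable[OF assms(1-4)])
  note field = dirderiv_field[OF assms(1) h2 assms(4) cd]
  \<comment> \<open>the covariant derivative along \<open>u\<close> of the field \<open>\<Gamma>(v,w)\<close>, paired with \<open>a\<close>\<close>
  have cov: "dirderiv h (d\<Gamma> u v w + \<Gamma> u (\<Gamma> v w)) x \<bullet> dirderiv h a x
      = dirderiv (dirderiv (dirderiv h w) v) u x \<bullet> dirderiv h a x + q v w \<bullet> q u a" for u v w a
  proof -
    have "dirderiv (\<lambda>y. dirderiv h (christoffel g y v w) y \<bullet> dirderiv h a y) u x
        = dirderiv (\<lambda>y. dirderiv (dirderiv h w) v y \<bullet> dirderiv h a y) u x"
      by (rule dirderiv_cong_open(2)[OF assms(1,4) \<Gamma>[symmetric]]) (auto intro: dirderiv_inner(1)[OF d1(3) d1(2)])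
    then have e: "dirderiv h (\<Gamma> v w) x \<bullet> dirderiv (dirderiv h a) u x
        + (dirderiv h (d\<Gamma> u v w) x + dirderiv (dirderiv h (\<Gamma> v w)) u x) \<bullet> dirderiv h a x
      = dirderiv (dirderiv h w) v x \<bullet> dirderiv (dirderiv h a) u x
        + dirderiv (dirderiv (dirderiv h w) v) u x \<bullet> dirderiv h a x"
      unfolding dirderiv_inner(2)[OF field(1) d1(2)] dirderiv_inner(2)[OF d1(3) d1(2)] field(2)
      by (simp add: \<Gamma>_def d\<Gamma>_def)
    have "dirderiv (dirderiv h (\<Gamma> v w)) u x \<bullet> dirderiv h a x = dirderiv h (\<Gamma> u (\<Gamma> v w)) x \<bullet> dirderiv h a x"
      using \<Gamma>[OF assms(4)] by (simp add: \<Gamma>_def)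
    moreover have "dirderiv (dirderiv h w) v x \<bullet> dirderiv (dirderiv h a) u x
       - dirderiv h (\<Gamma> v w) x \<bullet> dirderiv (dirderiv h a) u x = q v w \<bullet> q u a"
    proof -
      have "q v w \<bullet> dirderiv (dirderiv h a) u x = q v w \<bullet> q u a"
        using orth[of v w "\<Gamma> u a"] by (simp add: q_def \<Gamma>_def inner_diff_right)
      then show ?thesis by (simp add: q_def \<Gamma>_def inner_diff_left)
    qed
    ultimately show ?thesis using e by (simp add: add inner_add_left)
  qed
  have "riemann_curvature g x v w w = (d\<Gamma> v w w + \<Gamma> v (\<Gamma> w w)) - (d\<Gamma> w v w + \<Gamma> w (\<Gamma> v w))"
    by (simp add: riemann_curvature_def \<Gamma>_def d\<Gamma>_def)
  then have "g x (riemann_curvature g x v w w) v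
     = dirderiv h (d\<Gamma> v w w + \<Gamma> v (\<Gamma> w w)) x \<bullet> dirderiv h v x
       - dirderiv h (d\<Gamma> w v w + \<Gamma> w (\<Gamma> v w)) x \<bullet> dirderiv h v x"
    by (simp add: g_def induced_metric_def diff inner_diff_left)
  also have "\<dots> = q w w \<bullet> q v v - q v w \<bullet> q w v"
    unfolding cov by (simp add: sym3[of w w v])
  also have "q w v = q v w"
  proof -
    have "christoffel g x w v = christoffel g x v w"
      unfolding g_def christoffel_induced(1)[OF assms(1) h2 assms(4) assms(3)[OF assms(4)]]
      by (simp add: sym[of v w] cong: if_cong)
    then show ?thesis by (simp add: q_def sym[of v w])
  qed
  finally show "g x (riemann_curvature g x v w w) v = q v v \<bullet> q w w - q v w \<bullet> q v w"
    by (simp add: inner_commute)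
qed

text \<open>The second fundamental form takes values in a single line in both situations of interest: for a
  hypersurface, with \<open>n\<close> its unit normal, and for the singular submanifold of a front. The vector \<open>n\<close> is not
  normalised, which accounts for the division by \<open>n \<bullet> n\<close>.\<close>

lemma gauss_equation_normal_line:
  fixes h :: "real ^ 'n \<Rightarrow> 'b::euclidean_space"
  assumes "open S" "Ck_on 3 S h" "\<And>y. y \<in> S \<Longrightarrow> inj (frechet_derivative h (at y))" "x \<in> S"
    and n: "n \<noteq> 0" "\<And>u. dirderiv h u x \<bullet> n = 0"
    and line: "\<And>a b z. \<lbrakk>\<And>u. (dirderiv (dirderiv h b) a x - dirderiv h z x) \<bullet> dirderiv h u x = 0\<rbrakk>
        \<Longrightarrow> \<exists>\<mu>. dirderiv (dirderiv h b) a x - dirderiv h z x = \<mu> *\<^sub>R n"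
  defines "B \<equiv> \<lambda>v w. dirderiv (dirderiv h w) v x \<bullet> n"
  shows "sectional_curvature (induced_metric h) x v w
      = ((B v v * B w w - (B v w)\<^sup>2) / (n \<bullet> n)) /
        (induced_metric h x v v * induced_metric h x w w - (induced_metric h x v w)\<^sup>2)"
proof -
  let ?g = "induced_metric h"
  define q where "q v w = dirderiv (dirderiv h w) v x - dirderiv h (christoffel ?g x v w) x" for v w
  note gauss = gauss_equation[OF assms(1-4)]
  have qn: "q v w = (B v w / (n \<bullet> n)) *\<^sub>R n" for v w
  proof -
    obtain \<mu> where \<mu>: "q v w = \<mu> *\<^sub>R n"
      using line[of w v "christoffel ?g x v w"] gauss(1) unfolding q_def by blast
    have "q v w \<bullet> n = B v w" using n(2) by (simp add: q_def B_def inner_diff_left)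
    then show ?thesis using \<mu> n(1) by (auto simp: eq_divide_eq)
  qed
  have "?g x (riemann_curvature ?g x v w w) v = (B v v * B w w - (B v w)\<^sup>2) / (n \<bullet> n)"
    using n(1) gauss(2)[of v w] unfolding q_def[symmetric] qn by (simp add: field_simps power2_eq_square)
  then show ?thesis by (simp add: sectional_curvature_def)
qed

section \<open>Fronts and their second fundamental form\<close>

locale front_patch =
  fixes f \<nu> :: "real ^ 'm \<Rightarrow> real ^ 'm option" and W :: "(real ^ 'm) set"
  assumes open_W: "open W" and smooth_f: "smooth_on W f" and normal: "front_normal f W \<nu>"
begin

abbreviation "dens \<equiv> signed_density f \<nu>"

text \<open>The second fundamental form with respect to \<open>\<nu>\<close>. Unlike the curvature it is defined, and continuous, at
  singular points too.\<close>

definition II :: "real ^ 'm \<Rightarrow> real ^ 'm \<Rightarrow> real ^ 'm \<Rightarrow> real" where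
  "II x v w = dirderiv (dirderiv f w) v x \<bullet> \<nu> x"

definition gram :: "real ^ 'm \<Rightarrow> real ^ 'm \<Rightarrow> real ^ 'm \<Rightarrow> real" where
  "gram x v w = induced_metric f x v v * induced_metric f x w w - (induced_metric f x v w)\<^sup>2"

text \<open>The bound \<open>K \<ge> \<delta>\<close> at regular points, multiplied out so that both sides extend continuously to the
  singular points.\<close>

definition curvature_ge :: "real \<Rightarrow> bool" where
  "curvature_ge \<delta> \<longleftrightarrow> (\<forall>z v w. z \<in> W \<longrightarrow> dens z \<noteq> 0 \<longrightarrow> v \<noteq> w \<longrightarrow> independent {v, w} \<longrightarrow>
      \<delta> * gram z v w \<le> II z v v * II z w w - (II z v w)\<^sup>2)"

lemma Ck_f: "Ck_on k W f" and Ck_nu: "Ck_on k W \<nu>"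
  using smooth_f normal by (auto simp: smooth_on_def front_normal_def)

lemma diff_f: "x \<in> W \<Longrightarrow> f differentiable (at x)"
    "x \<in> W \<Longrightarrow> dirderiv f v differentiable (at x)"
  and diff_nu: "x \<in> W \<Longrightarrow> \<nu> differentiable (at x)"
    "x \<in> W \<Longrightarrow> dirderiv \<nu> v differentiable (at x)"
  using Ck_f[of 2] Ck_nu[of 2] by (simp_all add: numeral_2_eq_2)

lemma isCont_df: "x \<in> W \<Longrightarrow> isCont (dirderiv f v) x"
  and isCont_dnu: "x \<in> W \<Longrightarrow> isCont (dirderiv \<nu> v) x"
  using diff_f diff_nu by (simp_all add: differentiable_imp_continuous_within)

lemma symmetric_f: "x \<in> W \<Longrightarrow> dirderiv (dirderiv f v) w x = dirderiv (dirderiv f w) v x"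
  and symmetric_nu: "x \<in> W \<Longrightarrow> dirderiv (dirderiv \<nu> v) w x = dirderiv (dirderiv \<nu> w) v x"
  by (rule symmetric_dirderiv[OF open_W Ck_f], assumption, rule symmetric_dirderiv[OF open_W Ck_nu])

lemma tangent_normal: "x \<in> W \<Longrightarrow> dirderiv f v x \<bullet> \<nu> x = 0"
  using normal by (simp add: front_normal_def)

lemma nu_unit: "x \<in> W \<Longrightarrow> \<nu> x \<bullet> \<nu> x = 1"
  using normal by (simp add: front_normal_def dot_square_norm)

lemma dnu_normal:
  assumes "x \<in> W"
  shows "dirderiv \<nu> v x \<bullet> \<nu> x = 0"
proof -
  have "dirderiv (\<lambda>y. \<nu> y \<bullet> \<nu> y) v x = dirderiv (\<lambda>y. 1) v x"
    by (rule dirderiv_cong_open(2)[OF open_W assms]) (use nu_unit in auto)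
  then show ?thesis
    using dirderiv_inner(2)[OF diff_nu(1)[OF assms] diff_nu(1)[OF assms]] by (simp add: inner_commute)
qed

text \<open>Differentiation of the identity \<open>\<langle>df w, \<nu>\<rangle> = 0\<close>.\<close>

lemma II_eq:
  assumes "x \<in> W"
  shows "II x v w = - (dirderiv f w x \<bullet> dirderiv \<nu> v x)"
proof -
  have "dirderiv (\<lambda>y. dirderiv f w y \<bullet> \<nu> y) v x = dirderiv (\<lambda>y. 0) v x"
    by (rule dirderiv_cong_open(2)[OF open_W assms]) (use tangent_normal in auto)
  then show ?thesis
    using dirderiv_inner(2)[OF diff_f(2)[OF assms] diff_nu(1)[OF assms]] by (simp add: II_def)
qed

lemma II_sym: "x \<in> W \<Longrightarrow> II x v w = II x w v"
  unfolding II_def using symmetric_f by simp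

lemma dnu_null_orthogonal:
  assumes "x \<in> W" "dirderiv f \<eta> x = 0"
  shows "dirderiv f w x \<bullet> dirderiv \<nu> \<eta> x = 0"
  using II_eq[OF assms(1)] II_sym[OF assms(1), of \<eta> w] assms(2) by auto

lemma front_immersion:
  assumes "x \<in> W" "dirderiv f v x = 0" "dirderiv \<nu> v x = 0"
  shows "v = 0"
proof -
  have d: "((\<lambda>y. (f y, \<nu> y)) has_derivative (\<lambda>v. (dirderiv f v x, dirderiv \<nu> v x))) (at x)"
    by (intro has_derivative_Pair has_derivative_dirderiv diff_f diff_nu assms)
  have "inj (frechet_derivative (\<lambda>y. (f y, \<nu> y)) (at x))"
    using normal assms(1) by (auto simp: front_normal_def immersion_at_def)
  then have inj: "inj (\<lambda>v. (dirderiv f v x, dirderiv \<nu> v x))"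
    using frechet_derivative_at[OF d] by simp
  have "dirderiv f 0 x = 0" "dirderiv \<nu> 0 x = 0"
    using linear_0[OF linear_dirderiv[OF diff_f(1)[OF assms(1)]]]
      linear_0[OF linear_dirderiv[OF diff_nu(1)[OF assms(1)]]] by auto
  then show ?thesis using injD[OF inj, of v 0] assms by simp
qed

abbreviation frame where "frame x \<equiv> frame_matrix (\<lambda>v. dirderiv f v x) (\<nu> x)"

lemma density_frame: "dens x = det (frame x)"
  by (simp add: signed_density_def frame_matrix_def)

lemma frame_mult: "x \<in> W \<Longrightarrow> frame x *v c = dirderiv f (\<chi> k. c $ Some k) x + (c $ None) *\<^sub>R \<nu> x"
  by (rule frame_matrix_mult[OF linear_dirderiv[OF diff_f(1)]])

lemma Ck_frame: "Ck_on k W (\<lambda>x. frame x $ i $ j)"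
proof (cases j)
  case None
  then show ?thesis using Ck_on_vec_nth[OF open_W Ck_nu] by (simp add: frame_matrix_def)
next
  case (Some l)
  have "Ck_on k W (\<lambda>x. dirderiv f (axis l 1) x $ i)"
    by (rule Ck_on_vec_nth[OF open_W Ck_on_dirderiv[OF Ck_f]])
  then show ?thesis using Some by (simp add: frame_matrix_def)
qed

lemma Ck_density: "Ck_on k W dens"
  unfolding density_frame[abs_def] by (rule Ck_on_det[OF open_W Ck_frame])

lemma diff_density: "x \<in> W \<Longrightarrow> dens differentiable (at x)"
  using Ck_density[of "Suc 0"] by simp

definition lift0 :: "real ^ 'm \<Rightarrow> real ^ 'm option" where
  "lift0 v = (\<chi> j. case j of Some k \<Rightarrow> v $ k | None \<Rightarrow> 0)"

lemma frame_lift0: "x \<in> W \<Longrightarrow> frame x *v lift0 v = dirderiv f v x"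
  by (simp add: frame_mult lift0_def)

lemma density_nonzero_inj:
  assumes "x \<in> W" "dens x \<noteq> 0"
  shows "inj (frechet_derivative f (at x))"
proof -
  interpret linear "frechet_derivative f (at x)" using linear_dirderiv[OF diff_f(1)[OF assms(1)]] by simp
  have "v = 0" if "dirderiv f v x = 0" for v
  proof -
    have "lift0 v = 0"
      by (rule det_nonzero_kernel[of "frame x"]) (use assms that in \<open>auto simp: density_frame frame_lift0\<close>)
    then have "lift0 v $ Some k = 0" for k by simp
    then show "v = 0" by (simp add: vec_eq_iff lift0_def)
  qed
  then show ?thesis by (simp add: inj_iff_eq_0)
qed

lemma density_singular:
  assumes "x \<in> W" "\<not> immersion_at f x"
  shows "dens x = 0"
  using assms density_nonzero_inj diff_f(1) by (auto simp: immersion_at_def)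

lemma density_kernel:
  assumes "x \<in> W" "dirderiv f \<eta> x = 0" "\<eta> \<noteq> 0"
  shows "dens x = 0"
proof (rule density_singular[OF assms(1)])
  have "dirderiv f 0 x = 0" using linear_0[OF linear_dirderiv[OF diff_f(1)[OF assms(1)]]] .
  then show "\<not> immersion_at f x"
    using assms(2,3) injD[of "frechet_derivative f (at x)" \<eta> 0] by (auto simp: immersion_at_def)
qed

lemma regular_normal_space:
  assumes "x \<in> W" "dens x \<noteq> 0" "\<And>v. q \<bullet> dirderiv f v x = 0" "q \<bullet> \<nu> x = 0"
  shows "q = 0"
proof (rule det_nonzero_orthogonal_columns)
  show "det (frame x) \<noteq> 0" using assms(2) density_frame by simp
  show "(\<Sum>i\<in>UNIV. q $ i * frame x $ i $ j) = 0" for j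
    using assms(3,4) by (cases j) (simp_all add: frame_matrix_def inner_vec_def)
qed

lemma sectional_curvature_regular:
  assumes "x \<in> W" "dens x \<noteq> 0"
  shows "sectional_curvature (induced_metric f) x v w = (II x v v * II x w w - (II x v w)\<^sup>2) / gram x v w"
proof -
  let ?S = "{z \<in> W. dens z \<noteq> 0}"
  have S: "open ?S"
    using continuous_open_preimage[OF Ck_on_continuous[OF Ck_density[of 0]] open_W, of "-{0}"]
    by (simp add: vimage_def Int_def open_Compl)
  have x: "x \<in> ?S" using assms by simp
  have ck: "Ck_on 3 ?S f" by (rule Ck_on_subset[OF Ck_f]) auto
  have line: "\<exists>\<mu>. dirderiv (dirderiv f b) a x - dirderiv f z x = \<mu> *\<^sub>R \<nu> x"
    if "\<And>u. (dirderiv (dirderiv f b) a x - dirderiv f z x) \<bullet> dirderiv f u x = 0" for a b z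
  proof -
    let ?q = "dirderiv (dirderiv f b) a x - dirderiv f z x"
    have "\<nu> x \<bullet> dirderiv f v x = 0" for v using tangent_normal[OF assms(1)] by (simp add: inner_commute)
    then have t: "(?q - (?q \<bullet> \<nu> x) *\<^sub>R \<nu> x) \<bullet> dirderiv f v x = 0" for v
      using that[of v] by (simp only: inner_diff_left inner_scaleR_left)
    have n: "(?q - (?q \<bullet> \<nu> x) *\<^sub>R \<nu> x) \<bullet> \<nu> x = 0"
      by (simp only: inner_diff_left inner_scaleR_left nu_unit[OF assms(1)] mult_1_right diff_self)
    have "?q - (?q \<bullet> \<nu> x) *\<^sub>R \<nu> x = 0" by (rule regular_normal_space[OF assms t n])
    then show ?thesis by (intro exI[of _ "?q \<bullet> \<nu> x"]) simp
  qed
  have nz: "\<nu> x \<noteq> 0" using nu_unit[OF assms(1)] by auto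
  show ?thesis
    using gauss_equation_normal_line[OF S ck _ x nz tangent_normal[OF assms(1)] line]
      density_nonzero_inj nu_unit[OF assms(1)]
    by (simp add: II_def gram_def)
qed

text \<open>By Cramer's rule, replacing the column \<open>k\<close> of the frame at \<open>x + t \<eta>\<close> by \<open>df(\<eta>)\<close> multiplies the
  determinant by \<open>\<eta> $ k\<close>. The new column vanishes at \<open>t = 0\<close>, so it may be divided by \<open>t\<close>, and in the limit it becomes
  \<open>D\<^sub>\<eta> D\<^sub>\<eta> f\<close> while all other columns stay.\<close>

lemma null_derivative_density:
  assumes x: "x \<in> W" and ker: "dirderiv f \<eta> x = 0" and k: "\<eta> $ k \<noteq> 0"
  shows "\<eta> $ k * dirderiv dens \<eta> x
    = det (\<chi> i j. if j = Some k then dirderiv (dirderiv f \<eta>) \<eta> x $ i else frame x $ i $ j)"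
    (is "_ = det ?B")
proof -
  let ?l = "\<lambda>t. x + t *\<^sub>R \<eta>"
  let ?c = "\<lambda>t. (1 / t) *\<^sub>R dirderiv f \<eta> (?l t)"
  let ?M = "\<lambda>t. (\<chi> i j. if j = Some k then ?c t $ i else frame (?l t) $ i $ j) :: real ^ 'm option ^ 'm option"
  have l0: "dens x = 0" by (rule density_kernel[OF x ker]) (use k in auto)
  have "((\<lambda>t. (1 / t) *\<^sub>R (dens (?l t) - dens x)) \<longlongrightarrow> dirderiv dens \<eta> x) (at 0)"
    by (rule difference_quotient_along_line[OF diff_density[OF x]])
  then have lim1: "((\<lambda>t. \<eta> $ k * ((1 / t) *\<^sub>R dens (?l t))) \<longlongrightarrow> \<eta> $ k * dirderiv dens \<eta> x) (at 0)"
    unfolding l0 diff_zero by (rule tendsto_mult_left)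
  have c: "(?c \<longlongrightarrow> dirderiv (dirderiv f \<eta>) \<eta> x) (at 0)"
    using difference_quotient_along_line[OF diff_f(2)[OF x], of \<eta> \<eta>] ker by simp
  have fr: "((\<lambda>t. frame (?l t) $ i $ j) \<longlongrightarrow> frame x $ i $ j) (at 0)" for i j
    by (rule tendsto_along_line)
       (use Ck_on_continuous[OF Ck_frame[of 0]] x open_W in \<open>simp add: continuous_on_eq_continuous_at\<close>)
  have lim2: "((\<lambda>t. det (?M t)) \<longlongrightarrow> det ?B) (at 0)"
  proof (rule tendsto_det)
    show "((\<lambda>t. ?M t $ i $ j) \<longlongrightarrow> ?B $ i $ j) (at 0)" for i j
      using tendsto_vec_nth[OF c, of i] fr[of i j] by (cases "j = Some k") simp_all
  qed
  have "eventually (\<lambda>t. t \<noteq> 0 \<and> ?l t \<in> W) (at 0)"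
    by (intro eventually_conj eventually_along_line open_W x) (simp add: eventually_at_filter)
  then have "eventually (\<lambda>t. \<eta> $ k * ((1 / t) *\<^sub>R dens (?l t)) = det (?M t)) (at 0)"
  proof (rule eventually_mono)
    fix t assume t: "t \<noteq> 0 \<and> ?l t \<in> W"
    have "\<eta> $ k * dens (?l t)
        = det (\<chi> i j. if j = Some k then (frame (?l t) *v lift0 \<eta>) $ i else frame (?l t) $ i $ j)"
      unfolding cramer_lemma density_frame by (simp add: lift0_def)
    also have "\<dots> = det (\<chi> i j. if j = Some k then t * (?c t $ i) else frame (?l t) $ i $ j)"
      using t by (simp add: frame_lift0 cong: if_cong)
    also have "\<dots> = t * det (?M t)" by (rule det_column_scale)
    finally show "\<eta> $ k * ((1 / t) *\<^sub>R dens (?l t)) = det (?M t)" using t by (simp add: field_simps)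
  qed
  then have "((\<lambda>t. det (?M t)) \<longlongrightarrow> \<eta> $ k * dirderiv dens \<eta> x) (at 0)"
    using lim1 tendsto_cong[of "\<lambda>t. \<eta> $ k * ((1 / t) *\<^sub>R dens (?l t))" "\<lambda>t. det (?M t)"] by simp
  then show ?thesis using lim2 by (rule tendsto_unique[OF trivial_limit_at])
qed

end

section \<open>Singular points along the null direction\<close>

text \<open>What the \<open>A\<^sub>2\<close> condition provides at a singular point: a null vector along which the signed density has
  nonzero derivative.\<close>

locale null_direction = front_patch f \<nu> W
  for f \<nu> :: "real ^ 'm \<Rightarrow> real ^ 'm option" and W :: "(real ^ 'm) set" +
  fixes x \<eta> :: "real ^ 'm"
  assumes x: "x \<in> W" and null: "dirderiv f \<eta> x = 0" and transversal: "dirderiv dens \<eta> x \<noteq> 0"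
begin

text \<open>Together with \<open>\<nu>\<close> this vector spans the normal space of the image of \<open>df\<close> at the singular point.\<close>

definition n where "n = dirderiv \<nu> \<eta> x"

text \<open>The direction in which \<open>df(\<eta>)\<close> leaves zero along the null line.\<close>

definition h where "h = dirderiv (dirderiv f \<eta>) \<eta> x"

lemma eta_nonzero: "\<eta> \<noteq> 0"
  using transversal linear_0[OF linear_dirderiv[OF diff_density[OF x]]] by auto

lemma dens_zero: "dens x = 0"
  by (rule density_kernel[OF x null eta_nonzero])

lemma null_index: obtains k where "\<eta> $ k \<noteq> 0"
    "det (\<chi> i j. if j = Some k then h $ i else frame x $ i $ j) \<noteq> 0"
proof -
  obtain k where k: "\<eta> $ k \<noteq> 0" using eta_nonzero by (auto simp: vec_eq_iff)
  have "det (\<chi> i j. if j = Some k then h $ i else frame x $ i $ j) \<noteq> 0"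
    using null_derivative_density[OF x null k] transversal k unfolding h_def[symmetric] by auto
  then show thesis using that k by blast
qed

text \<open>The vectors \<open>h\<close>, \<open>\<nu>\<close> and the image of \<open>df\<close> span the target, since the determinant in
  \<open>null_derivative_density\<close> is nonzero.\<close>

lemma orthogonal_all:
  assumes "\<And>v. q \<bullet> dirderiv f v x = 0" "q \<bullet> \<nu> x = 0" "q \<bullet> h = 0"
  shows "q = 0"
proof -
  obtain k where k: "det (\<chi> i j. if j = Some k then h $ i else frame x $ i $ j) \<noteq> 0"
    by (rule null_index)
  show ?thesis
  proof (rule det_nonzero_orthogonal_columns[OF k])
    fix j
    show "(\<Sum>i\<in>UNIV. q $ i * (\<chi> i j. if j = Some k then h $ i else frame x $ i $ j) $ i $ j) = 0"
    proof (cases "j = Some k")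
      case True
      then show ?thesis using assms(3) by (simp add: inner_vec_def)
    next
      case False
      then show ?thesis using assms(1,2) by (cases j) (simp_all add: frame_matrix_def inner_vec_def)
    qed
  qed
qed

lemma tangent_n: "dirderiv f v x \<bullet> n = 0"
  unfolding n_def by (rule dnu_null_orthogonal[OF x null])

lemma n_nonzero: "n \<noteq> 0"
  using front_immersion[OF x null] eta_nonzero by (auto simp: n_def)

text \<open>The vector \<open>n\<close> is orthogonal to \<open>\<nu>\<close> and to the image of \<open>df\<close>. Were it also orthogonal to \<open>h\<close>, it would be zero,
  and \<open>\<eta>\<close> would be annihilated by both \<open>df\<close> and \<open>d\<nu>\<close>, against the front condition.\<close>

lemma h_n: "h \<bullet> n \<noteq> 0"
proof
  assume "h \<bullet> n = 0"
  then have "n = 0"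
    using tangent_n dnu_normal[OF x, of \<eta>] by (intro orthogonal_all) (auto simp: inner_commute n_def)
  then show False using n_nonzero by simp
qed

text \<open>Subtracting the multiple of \<open>n\<close> with the same product with \<open>h\<close> leaves a vector orthogonal to everything.\<close>

lemma normal_line:
  assumes "\<And>v. q \<bullet> dirderiv f v x = 0" "q \<bullet> \<nu> x = 0"
  shows "\<exists>\<mu>. q = \<mu> *\<^sub>R n"
proof -
  let ?m = "(q \<bullet> h) / (h \<bullet> n)"
  have nu: "n \<bullet> \<nu> x = 0" unfolding n_def by (rule dnu_normal[OF x])
  have nt: "n \<bullet> dirderiv f v x = 0" for v using tangent_n by (simp add: inner_commute)
  have "q - ?m *\<^sub>R n = 0"
  proof (rule orthogonal_all)
    show "(q - ?m *\<^sub>R n) \<bullet> dirderiv f v x = 0" for v using assms(1) nt by (simp add: inner_diff_left)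
    show "(q - ?m *\<^sub>R n) \<bullet> \<nu> x = 0" using assms(2) nu by (simp add: inner_diff_left)
    show "(q - ?m *\<^sub>R n) \<bullet> h = 0" using h_n by (simp add: inner_diff_left inner_commute[of n h])
  qed
  then show ?thesis by (intro exI[of _ ?m]) simp
qed

text \<open>After subtracting a multiple of \<open>\<eta>\<close> the coordinate \<open>k\<close> of \<open>a\<close> is zero, and then the replaced column does
  not enter: the invertible matrix maps \<open>a\<close> to \<open>df(a) = 0\<close>.\<close>

lemma kernel_line:
  assumes "dirderiv f a x = 0"
  shows "\<exists>s. a = s *\<^sub>R \<eta>"
proof -
  obtain k where k: "\<eta> $ k \<noteq> 0" "det (\<chi> i j. if j = Some k then h $ i else frame x $ i $ j) \<noteq> 0"
    by (rule null_index)
  interpret linear "\<lambda>v. dirderiv f v x" by (rule linear_dirderiv[OF diff_f(1)[OF x]])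
  let ?a = "a - (a $ k / \<eta> $ k) *\<^sub>R \<eta>"
  let ?B = "\<chi> i j. if j = Some k then h $ i else frame x $ i $ j"
  have ak: "lift0 ?a $ Some k = 0" using k by (simp add: lift0_def)
  have "?B *v lift0 ?a = frame x *v lift0 ?a"
    unfolding matrix_vector_mult_def by (auto simp: vec_eq_iff ak intro!: sum.cong)
  also have "\<dots> = 0" using assms null by (simp add: frame_lift0[OF x] diff scale)
  finally have "lift0 ?a = 0" by (rule det_nonzero_kernel[OF k(2)])
  then have "lift0 ?a $ Some i = 0" for i by (simp only: zero_index)
  then have "?a $ i = 0" for i by (simp only: lift0_def vec_lambda_beta option.case)
  then have "?a = 0" by (simp only: vec_eq_iff zero_index simp_thms)
  then show ?thesis by (intro exI[of _ "a $ k / \<eta> $ k"]) simp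
qed

abbreviation "ell t \<equiv> x + t *\<^sub>R \<eta>"
text \<open>The difference quotient of \<open>df(\<eta>)\<close>, since \<open>df(\<eta>)\<close> is zero at \<open>t = 0\<close>.\<close>

abbreviation "hq t \<equiv> (1 / t) *\<^sub>R dirderiv f \<eta> (ell t)"

lemma hq_lim: "(hq \<longlongrightarrow> h) (at 0)"
  using difference_quotient_along_line[OF diff_f(2)[OF x], of \<eta> \<eta>] null by (simp add: h_def)

lemma dnu_lim: "((\<lambda>t. dirderiv \<nu> w (ell t)) \<longlongrightarrow> dirderiv \<nu> w x) (at 0)"
  and df_lim: "((\<lambda>t. dirderiv f w (ell t)) \<longlongrightarrow> dirderiv f w x) (at 0)"
  by (rule tendsto_along_line[OF isCont_dnu[OF x]], rule tendsto_along_line[OF isCont_df[OF x]])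

lemma eventually_regular: "eventually (\<lambda>t. t \<noteq> 0 \<and> ell t \<in> W \<and> dens (ell t) \<noteq> 0) (at 0)"
proof -
  have "((\<lambda>t. (1 / t) *\<^sub>R (dens (ell t) - dens x)) \<longlongrightarrow> dirderiv dens \<eta> x) (at 0)"
    by (rule difference_quotient_along_line[OF diff_density[OF x]])
  then have "eventually (\<lambda>t. (1 / t) *\<^sub>R (dens (ell t) - dens x) \<noteq> 0) (at 0)"
    by (rule tendsto_imp_eventually_ne[OF _ transversal])
  then have "eventually (\<lambda>t. t \<noteq> 0 \<and> dens (ell t) \<noteq> 0) (at 0)"
    by (rule eventually_mono) (auto simp: dens_zero)
  with eventually_along_line[OF open_W x, of \<eta>] show ?thesis
    by eventually_elim simp
qed

text \<open>The curvature bound on the null line, with a factor \<open>t\<close> extracted from every occurrence of \<open>df(\<eta>)\<close>.\<close>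

lemma line_inequality:
  assumes bound: "curvature_ge \<delta>"
    and w: "dirderiv f w x \<noteq> 0"
  shows "eventually (\<lambda>t. t \<noteq> 0 \<and>
      t\<^sup>2 * (\<delta> * ((hq t \<bullet> hq t) * (dirderiv f w (ell t) \<bullet> dirderiv f w (ell t)) - (hq t \<bullet> dirderiv f w (ell t))\<^sup>2))
     \<le> t * ((hq t \<bullet> dirderiv \<nu> \<eta> (ell t)) * (dirderiv f w (ell t) \<bullet> dirderiv \<nu> w (ell t)))
        - t\<^sup>2 * (hq t \<bullet> dirderiv \<nu> w (ell t))\<^sup>2) (at 0)"
  using eventually_regular
proof (rule eventually_mono)
  fix t assume t: "t \<noteq> 0 \<and> ell t \<in> W \<and> dens (ell t) \<noteq> 0"
  have "w \<noteq> s *\<^sub>R \<eta>" for s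
    using w null linear_scale[OF linear_dirderiv[OF diff_f(1)[OF x]], of s \<eta>] by auto
  note ind = independent_pair[OF eta_nonzero this]
  define H where "H = hq t"
  define w' where "w' = dirderiv f w (ell t)"
  have df: "dirderiv f \<eta> (ell t) = t *\<^sub>R H" using t by (simp add: H_def)
  have "\<delta> * gram (ell t) \<eta> w \<le> II (ell t) \<eta> \<eta> * II (ell t) w w - (II (ell t) \<eta> w)\<^sup>2"
    using bound ind t unfolding curvature_ge_def by blast
  moreover have "gram (ell t) \<eta> w = t\<^sup>2 * ((H \<bullet> H) * (w' \<bullet> w') - (H \<bullet> w')\<^sup>2)"
    unfolding gram_def induced_metric_def df w'_def[symmetric]
    by (simp add: power2_eq_square algebra_simps)
  moreover have "II (ell t) \<eta> \<eta> = - (t * (H \<bullet> dirderiv \<nu> \<eta> (ell t)))"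
    using t II_eq[of "ell t" \<eta> \<eta>] by (simp only: df inner_scaleR_left)
  moreover have "II (ell t) \<eta> w = - (t * (H \<bullet> dirderiv \<nu> w (ell t)))"
    using t II_eq[of "ell t" w \<eta>] II_sym[of "ell t" w \<eta>] by (simp only: df inner_scaleR_left)
  moreover have "II (ell t) w w = - (w' \<bullet> dirderiv \<nu> w (ell t))"
    using t II_eq unfolding w'_def by blast
  moreover have "t\<^sup>2 * (\<delta> * g) \<le> t * (a * b) - t\<^sup>2 * c\<^sup>2"
    if "\<delta> * (t\<^sup>2 * g) \<le> - (t * a) * - b - (- (t * c))\<^sup>2" for a b c g
    using that by (simp add: power2_eq_square algebra_simps)
  ultimately have ineq: "t\<^sup>2 * (\<delta> * ((H \<bullet> H) * (w' \<bullet> w') - (H \<bullet> w')\<^sup>2))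
     \<le> t * ((H \<bullet> dirderiv \<nu> \<eta> (ell t)) * (w' \<bullet> dirderiv \<nu> w (ell t))) - t\<^sup>2 * (H \<bullet> dirderiv \<nu> w (ell t))\<^sup>2"
    by (simp only:)
  show "t \<noteq> 0 \<and>
      t\<^sup>2 * (\<delta> * ((hq t \<bullet> hq t) * (dirderiv f w (ell t) \<bullet> dirderiv f w (ell t)) - (hq t \<bullet> dirderiv f w (ell t))\<^sup>2))
     \<le> t * ((hq t \<bullet> dirderiv \<nu> \<eta> (ell t)) * (dirderiv f w (ell t) \<bullet> dirderiv \<nu> w (ell t)))
        - t\<^sup>2 * (hq t \<bullet> dirderiv \<nu> w (ell t))\<^sup>2"
    unfolding H_def[symmetric] w'_def[symmetric] by (rule conjI[OF conjunct1[OF t] ineq])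
qed

text \<open>Divided by \<open>t\<close>, the inequality on the null line has the limit \<open>\<langle>h, n\<rangle> \<langle>df w, d\<nu> w\<rangle>\<close>, which is nonnegative
  when approached from the right and nonpositive when approached from the left. So the diagonal of the form vanishes,
  and by symmetry the form.\<close>

lemma second_form_vanishes:
  assumes "\<delta> \<ge> 0"
    and bound: "curvature_ge \<delta>"
  shows "dirderiv f a x \<bullet> dirderiv \<nu> b x = 0"
proof -
  have diag: "dirderiv f w x \<bullet> dirderiv \<nu> w x = 0" for w
  proof (cases "dirderiv f w x = 0")
    case False
    let ?L = "\<lambda>t. dirderiv f w (ell t) \<bullet> dirderiv \<nu> w (ell t)"
    let ?X = "\<lambda>t. (hq t \<bullet> dirderiv \<nu> \<eta> (ell t)) * ?L t - t * (hq t \<bullet> dirderiv \<nu> w (ell t))\<^sup>2"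
    let ?lim = "(h \<bullet> n) * (dirderiv f w x \<bullet> dirderiv \<nu> w x)"
    have "(?X \<longlongrightarrow> (h \<bullet> dirderiv \<nu> \<eta> x) * (dirderiv f w x \<bullet> dirderiv \<nu> w x) - 0 * (h \<bullet> dirderiv \<nu> w x)\<^sup>2) (at 0)"
      by (intro tendsto_diff tendsto_mult tendsto_inner tendsto_power hq_lim dnu_lim df_lim tendsto_ident_at)
    then have X: "(?X \<longlongrightarrow> ?lim) (at 0)" by (simp add: n_def)
    have ev: "eventually (\<lambda>t. 0 \<le> t * ?X t) (at 0)"
      using line_inequality[OF bound False]
    proof (rule eventually_mono)
      fix t
      have "0 \<le> (hq t \<bullet> hq t) * (dirderiv f w (ell t) \<bullet> dirderiv f w (ell t)) - (hq t \<bullet> dirderiv f w (ell t))\<^sup>2"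
        (is "0 \<le> ?g")
        using Cauchy_Schwarz_ineq[of "hq t" "dirderiv f w (ell t)"] by linarith
      then have g: "0 \<le> t\<^sup>2 * (\<delta> * ?g)"
        by (rule mult_nonneg_nonneg[OF zero_le_power2 mult_nonneg_nonneg[OF assms(1)]])
      assume ineq: "t \<noteq> 0 \<and> t\<^sup>2 * (\<delta> * ?g)
        \<le> t * ((hq t \<bullet> dirderiv \<nu> \<eta> (ell t)) * ?L t) - t\<^sup>2 * (hq t \<bullet> dirderiv \<nu> w (ell t))\<^sup>2"
      have factor: "t * (a - t * b) = t * a - t\<^sup>2 * b" for a b
        by (simp add: right_diff_distrib power2_eq_square)
      show "0 \<le> t * ?X t"
        unfolding factor by (rule order_trans[OF g conjunct2[OF ineq]])
    qed
    have "?lim \<ge> 0"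
    proof (rule tendsto_lowerbound)
      show "(?X \<longlongrightarrow> ?lim) (at_right 0)" using X unfolding filterlim_at_split by (rule conjunct2)
      have "eventually (\<lambda>t::real. t > 0) (at_right 0)" by (simp add: eventually_at_right_less)
      moreover have "eventually (\<lambda>t. 0 \<le> t * ?X t) (at_right 0)" using ev unfolding eventually_at_split by (rule conjunct2)
      ultimately show "eventually (\<lambda>t. 0 \<le> ?X t) (at_right 0)"
        by eventually_elim (simp add: zero_le_mult_iff)
    qed simp
    moreover have "?lim \<le> 0"
    proof (rule tendsto_upperbound)
      show "(?X \<longlongrightarrow> ?lim) (at_left 0)" using X unfolding filterlim_at_split by (rule conjunct1)
      have "eventually (\<lambda>t::real. t < 0) (at_left 0)" by (simp add: eventually_at_filter)
      moreover have "eventually (\<lambda>t. 0 \<le> t * ?X t) (at_left 0)" using ev unfolding eventually_at_split by (rule conjunct1)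
      ultimately show "eventually (\<lambda>t. ?X t \<le> 0) (at_left 0)"
        by eventually_elim (simp add: zero_le_mult_iff)
    qed simp
    ultimately have "?lim = 0" by (rule order_antisym[rotated])
    then show ?thesis using h_n by (simp only: mult_eq_0_iff simp_thms)
  qed simp
  have sym: "dirderiv f a x \<bullet> dirderiv \<nu> b x = dirderiv f b x \<bullet> dirderiv \<nu> a x"
    using II_eq[OF x] II_sym[OF x, of a b] by simp
  have "dirderiv f (a + b) x \<bullet> dirderiv \<nu> (a + b) x = 0" by (rule diag)
  then show ?thesis
    using diag[of a] diag[of b] sym
    by (simp add: linear_add[OF linear_dirderiv[OF diff_f(1)[OF x]]]
        linear_add[OF linear_dirderiv[OF diff_nu(1)[OF x]]] inner_add_left inner_add_right)
qed

text \<open>The second-order term of the inequality on the null line. The hypothesis on the derivative along \<open>w\<close>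
  holds for \<open>w\<close> tangent to the singular set because \<open>II\<close> vanishes there identically.\<close>

lemma singular_curvature_bound:
  assumes bound: "curvature_ge \<delta>"
    and vanish: "\<And>a b. dirderiv f a x \<bullet> dirderiv \<nu> b x = 0"
    and vanish_deriv: "\<And>a b. dirderiv (\<lambda>z. dirderiv f a z \<bullet> dirderiv \<nu> b z) w x = 0"
    and w: "dirderiv f w x \<noteq> 0"
  shows "\<delta> * ((h \<bullet> h) * (dirderiv f w x \<bullet> dirderiv f w x) - (h \<bullet> dirderiv f w x)\<^sup>2)
      \<le> - (h \<bullet> n) * (dirderiv (dirderiv f w) w x \<bullet> n)"
proof -
  let ?G = "\<lambda>z. dirderiv f w z \<bullet> dirderiv \<nu> w z"
  note inner = dirderiv_inner[OF diff_f(2)[OF x] diff_nu(2)[OF x]]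
  have "dirderiv ?G \<eta> x = - (dirderiv (dirderiv f w) w x \<bullet> n)"
  proof -
    have "dirderiv (dirderiv f \<eta>) w x \<bullet> dirderiv \<nu> w x = 0"
      using vanish_deriv[of \<eta> w] null unfolding inner(2) by simp
    moreover have "dirderiv f w x \<bullet> dirderiv (dirderiv \<nu> \<eta>) w x + dirderiv (dirderiv f w) w x \<bullet> n = 0"
      using vanish_deriv[of w \<eta>] unfolding inner(2) n_def by simp
    ultimately show ?thesis
      unfolding inner(2) using symmetric_f[OF x, of w \<eta>] symmetric_nu[OF x, of w \<eta>] by simp
  qed
  then have Lq: "((\<lambda>t. (1 / t) * ?G (ell t)) \<longlongrightarrow> - (dirderiv (dirderiv f w) w x \<bullet> n)) (at 0)"
    using difference_quotient_along_line[OF inner(1), of \<eta> w w] vanish by simp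
  have liml: "((\<lambda>t. \<delta> * ((hq t \<bullet> hq t) * (dirderiv f w (ell t) \<bullet> dirderiv f w (ell t)) - (hq t \<bullet> dirderiv f w (ell t))\<^sup>2))
      \<longlongrightarrow> \<delta> * ((h \<bullet> h) * (dirderiv f w x \<bullet> dirderiv f w x) - (h \<bullet> dirderiv f w x)\<^sup>2)) (at 0)"
    by (intro tendsto_diff tendsto_mult tendsto_inner tendsto_power hq_lim df_lim tendsto_const)
  have limr: "((\<lambda>t. (hq t \<bullet> dirderiv \<nu> \<eta> (ell t)) * ((1 / t) * ?G (ell t)) - (hq t \<bullet> dirderiv \<nu> w (ell t))\<^sup>2)
      \<longlongrightarrow> (h \<bullet> n) * (- (dirderiv (dirderiv f w) w x \<bullet> n)) - (h \<bullet> dirderiv \<nu> w x)\<^sup>2) (at 0)"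
    unfolding n_def
    by (intro tendsto_diff tendsto_mult tendsto_inner tendsto_power hq_lim dnu_lim Lq[unfolded n_def])
  have ev: "eventually (\<lambda>t. \<delta> * ((hq t \<bullet> hq t) * (dirderiv f w (ell t) \<bullet> dirderiv f w (ell t)) - (hq t \<bullet> dirderiv f w (ell t))\<^sup>2)
      \<le> (hq t \<bullet> dirderiv \<nu> \<eta> (ell t)) * ((1 / t) * ?G (ell t)) - (hq t \<bullet> dirderiv \<nu> w (ell t))\<^sup>2) (at 0)"
    using line_inequality[OF bound w]
  proof eventually_elim
    case (elim t)
    have div: "A \<le> N * ((1 / t) * L) - M" if "t \<noteq> 0" "t\<^sup>2 * A \<le> t * (N * L) - t\<^sup>2 * M" for A N L M :: real
    proof -
      have "t * (N * L) - t\<^sup>2 * M = t\<^sup>2 * (N * ((1 / t) * L) - M)"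
        using that(1) by (simp add: field_simps power2_eq_square)
      then show ?thesis using that by (simp add: mult_le_cancel_left)
    qed
    show ?case by (rule div) (use elim in blast)+
  qed
  have "\<delta> * ((h \<bullet> h) * (dirderiv f w x \<bullet> dirderiv f w x) - (h \<bullet> dirderiv f w x)\<^sup>2)
      \<le> (h \<bullet> n) * (- (dirderiv (dirderiv f w) w x \<bullet> n)) - (h \<bullet> dirderiv \<nu> w x)\<^sup>2"
    by (rule tendsto_le[OF trivial_limit_at limr liml ev])
  then show ?thesis using zero_le_power2[of "h \<bullet> dirderiv \<nu> w x"]
    by (simp only: mult_minus_left mult_minus_right)
qed

text \<open>The vector \<open>h\<close> is not a multiple of \<open>df w\<close>, because \<open>n\<close> is orthogonal to \<open>df w\<close> but not to \<open>h\<close>.\<close>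

lemma gram_tangent_h_pos:
  assumes w: "dirderiv f w x \<noteq> 0"
  shows "(h \<bullet> dirderiv f w x)\<^sup>2 < (h \<bullet> h) * (dirderiv f w x \<bullet> dirderiv f w x)"
proof -
  have "h \<noteq> s *\<^sub>R dirderiv f w x" for s using h_n tangent_n[of w] by auto
  note ind = independent_pair[OF w this]
  have "(dirderiv f w x \<bullet> h)\<^sup>2 < (dirderiv f w x \<bullet> dirderiv f w x) * (h \<bullet> h)"
    by (rule quadratic_form_discriminant(2)[where P="(\<bullet>)", OF _ _ _ _ ind])
       (rule inner_add_left, rule inner_scaleR_left, rule inner_commute, simp)
  then show ?thesis by (simp add: inner_commute mult.commute)
qed

end

section \<open>The curvature of the singular submanifold\<close>

context front_patch
begin

lemma curvature_geI:
  assumes "\<And>z \<kappa>. \<lbrakk>z \<in> W; dens z \<noteq> 0; \<kappa> \<in> sectional_curvatures_at (induced_metric f) z\<rbrakk> \<Longrightarrow> \<delta> \<le> \<kappa>"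
  shows "curvature_ge \<delta>"
  unfolding curvature_ge_def
proof (intro allI impI)
  fix z v w :: "real ^ 'm" assume z: "z \<in> W" "dens z \<noteq> 0" and vw: "v \<noteq> w" "independent {v, w}"
  have lin: "linear (frechet_derivative f (at z))"
    using linear_dirderiv[OF diff_f(1)[OF z(1)]] by simp
  have "gram z v w > 0"
    using gram_determinant_pos[OF lin density_nonzero_inj[OF z] vw] by (simp add: gram_def induced_metric_def)
  moreover have "\<delta> \<le> sectional_curvature (induced_metric f) z v w"
    by (rule assms[OF z]) (use vw in \<open>auto simp: sectional_curvatures_at_def\<close>)
  ultimately show "\<delta> * gram z v w \<le> II z v v * II z w w - (II z v w)\<^sup>2"
    unfolding sectional_curvature_regular[OF z] by (simp add: pos_le_divide_eq)
qed

text \<open>The density vanishes along every curve in the singular set.\<close>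

lemma density_tangent:
  assumes S: "\<And>z. \<lbrakk>z \<in> S; z \<in> W\<rbrakk> \<Longrightarrow> dens z = 0" and p: "p \<in> W" and v: "v \<in> tangent_space_at S p"
  shows "dirderiv dens v p = 0"
proof -
  obtain \<gamma> e where \<gamma>: "e > 0" "smooth_on {-e<..<e::real} \<gamma>" "\<gamma> ` {-e<..<e} \<subseteq> S" "\<gamma> 0 = p"
      "(\<gamma> has_vector_derivative v) (at 0)"
    using v unfolding tangent_space_at_def by blast
  let ?I = "{-e<..<e} \<inter> \<gamma> -` W"
  have "continuous_on {-e<..<e} \<gamma>" using \<gamma>(2) Ck_on.simps(1) unfolding smooth_on_def by blast
  then have I: "open ?I" by (rule continuous_open_preimage[OF _ open_greaterThanLessThan open_W])
  have 0: "0 \<in> ?I" using \<gamma> p by simp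
  have g: "(\<gamma> has_derivative (\<lambda>t. t *\<^sub>R v)) (at 0)" using \<gamma>(5) by (simp add: has_vector_derivative_def)
  have "((dens \<circ> \<gamma>) has_derivative ((\<lambda>u. dirderiv dens u p) \<circ> (\<lambda>t. t *\<^sub>R v))) (at 0)"
    by (rule diff_chain_at[OF g]) (use \<gamma>(4) has_derivative_dirderiv[OF diff_density[OF p]] in simp)
  moreover have "((dens \<circ> \<gamma>) has_derivative (\<lambda>t. 0)) (at 0)"
  proof (rule has_derivative_transform_within_open[OF _ I 0])
    show "((\<lambda>t::real. 0::real) has_derivative (\<lambda>t. 0)) (at 0)" by (rule has_derivative_const)
    fix t assume "t \<in> ?I"
    then show "0 = (dens \<circ> \<gamma>) t" using S[of "\<gamma> t"] \<gamma>(3) by (simp add: image_subset_iff)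
  qed
  ultimately have "((\<lambda>u. dirderiv dens u p) \<circ> (\<lambda>t. t *\<^sub>R v)) = (\<lambda>t. 0)" by (rule has_derivative_unique)
  from fun_cong[OF this, of 1] show ?thesis by simp
qed

text \<open>The derivative of the density is a nonzero functional that vanishes on the tangent vectors of the
  singular set, so it cannot vanish on the null space that complements them.\<close>

lemma exists_null_direction:
  assumes S: "\<And>z. \<lbrakk>z \<in> S; z \<in> W\<rbrakk> \<Longrightarrow> dens z = 0" and p: "p \<in> W"
    and span: "{v. dirderiv f v p = 0} + tangent_space_at S p = UNIV"
    and e: "dirderiv dens e p \<noteq> 0"
  shows "\<exists>\<eta>. null_direction f \<nu> W p \<eta>"
proof -
  have "e \<in> {v. dirderiv f v p = 0} + tangent_space_at S p" using span by simp
  then obtain a b where ab: "e = a + b" "dirderiv f a p = 0" "b \<in> tangent_space_at S p"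
    by (auto elim: set_plus_elim)
  have "dirderiv dens b p = 0" using density_tangent[OF S p ab(3)] by blast
  then have "dirderiv dens a p \<noteq> 0"
    using e linear_add[OF linear_dirderiv[OF diff_density[OF p]], of a b] by (simp add: ab(1))
  then have "null_direction f \<nu> W p a" using p ab(2) by unfold_locales
  then show ?thesis by blast
qed

text \<open>The second fundamental form of \<open>f \<circ> \<phi>\<close> is the form \<open>P\<close> with values in the line of \<open>n\<close>. Multiplied by
  the nonzero number \<open>- \<langle>h, n\<rangle>\<close> it becomes the form \<open>Q\<close> that \<open>singular_curvature_bound\<close> estimates from below, and the
  minors of \<open>P\<close> and \<open>Q\<close> have the same sign.\<close>

lemma singular_submanifold_curvature:
  fixes \<phi> :: "real ^ 'k \<Rightarrow> real ^ 'm"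
  assumes V: "open V" "smooth_on V \<phi>" "\<And>y. y \<in> V \<Longrightarrow> immersion_at \<phi> y" "\<phi> ` V \<subseteq> S"
    and y: "y \<in> V" "\<phi> y \<in> W"
    and card: "CARD('k) + 1 = CARD('m)"
    and S: "\<And>z. \<lbrakk>z \<in> S; z \<in> W\<rbrakk> \<Longrightarrow> dens z = 0"
    and span: "\<And>z. \<lbrakk>z \<in> S; z \<in> W\<rbrakk> \<Longrightarrow> {v. dirderiv f v z = 0} + tangent_space_at S z = UNIV"
    and nondeg: "dirderiv dens e (\<phi> y) \<noteq> 0"
    and \<delta>: "\<delta> \<ge> 0" "curvature_ge \<delta>"
    and \<kappa>: "\<kappa> \<in> sectional_curvatures_at (induced_metric (f \<circ> \<phi>)) y"
  shows "\<kappa> \<ge> 0" and "\<delta> > 0 \<Longrightarrow> \<kappa> > 0"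
proof -
  define W' where "W' = W \<inter> dirderiv dens e -` (- {0})"
  \<comment> \<open>Non-degeneracy is assumed for some normal field at each singular point. Restricting to points where the density
    of the given \<open>\<nu>\<close> still has nonzero derivative allows the same \<open>\<nu>\<close> to be used on a whole neighbourhood, over which the
    identity \<open>II = 0\<close> is differentiated below.\<close>
  define V' where "V' = V \<inter> \<phi> -` W'"
  have W': "open W'" unfolding W'_def
    by (rule continuous_open_preimage[OF _ open_W])
       (use Ck_on_continuous[OF Ck_on_dirderiv[OF Ck_density[of "Suc 0"]]] in \<open>auto simp: open_Compl\<close>)
  have Ck_phi: "Ck_on k V \<phi>" for k using V(2) by (simp add: smooth_on_def)
  have V': "open V'" unfolding V'_def
    by (rule continuous_open_preimage[OF Ck_on_continuous[OF Ck_phi] V(1) W'])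
  have y': "y \<in> V'" using y nondeg by (simp add: V'_def W'_def)
  have in_V': "z \<in> V" "\<phi> z \<in> W" "\<phi> z \<in> S" "dirderiv dens e (\<phi> z) \<noteq> 0" if "z \<in> V'" for z
    using that V(4) by (auto simp: V'_def W'_def)
  have d\<phi>: "\<phi> differentiable (at z)" "dirderiv \<phi> b differentiable (at z)" if "z \<in> V'" for z b
    using Ck_phi[of 2] in_V'(1)[OF that] by (auto simp: numeral_2_eq_2)
  have nd: "\<exists>\<eta>. null_direction f \<nu> W (\<phi> z) \<eta>" if "z \<in> V'" for z
    using exists_null_direction[OF S in_V'(2)[OF that] span[OF in_V'(3,2)[OF that]] in_V'(4)[OF that]]
    by blast
  have dens_phi: "dirderiv dens (dirderiv \<phi> b z) (\<phi> z) = 0" if "z \<in> V'" for z b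
  proof -
    have "dirderiv (dens \<circ> \<phi>) b z = dirderiv (\<lambda>z. 0) b z"
      by (rule dirderiv_cong_open(2)[OF V' that]) (use S in_V' in auto)
    then show ?thesis
      using dirderiv_compose(2)[OF d\<phi>(1)[OF that] diff_density[OF in_V'(2)[OF that]]] by simp
  qed
  have vanish: "dirderiv f a (\<phi> z) \<bullet> dirderiv \<nu> b (\<phi> z) = 0" if "z \<in> V'" for z a b
    using nd[OF that] null_direction.second_form_vanishes \<delta> by blast
  have inj_phi: "inj (\<lambda>b. dirderiv \<phi> b z)" if "z \<in> V'" for z
    using V(3)[OF in_V'(1)[OF that]] by (simp add: immersion_at_def)
  have dF: "dirderiv (f \<circ> \<phi>) b z = dirderiv f (dirderiv \<phi> b z) (\<phi> z)" if "z \<in> V'" for z b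
    by (rule dirderiv_compose(2)[OF d\<phi>(1)[OF that] diff_f(1)[OF in_V'(2)[OF that]]])
  have lin_F: "linear (\<lambda>b. dirderiv (f \<circ> \<phi>) b z)" if "z \<in> V'" for z
    by (rule linear_dirderiv[OF dirderiv_compose(1)[OF d\<phi>(1)[OF that] diff_f(1)[OF in_V'(2)[OF that]]]])
  have F_inj: "inj (\<lambda>b. dirderiv (f \<circ> \<phi>) b z)" if zV: "z \<in> V'" for z
    unfolding linear_inj_iff_eq_0[OF lin_F[OF zV]]
  proof (intro allI impI)
    fix b assume "dirderiv (f \<circ> \<phi>) b z = 0"
    then have k: "dirderiv f (dirderiv \<phi> b z) (\<phi> z) = 0" using dF[OF zV] by simp
    obtain \<eta> where "null_direction f \<nu> W (\<phi> z) \<eta>" using nd[OF zV] by blast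
    then interpret N: null_direction f \<nu> W "\<phi> z" \<eta> .
    obtain s where s: "dirderiv \<phi> b z = s *\<^sub>R \<eta>" using N.kernel_line[OF k] by blast
    have "s * dirderiv dens \<eta> (\<phi> z) = 0"
      using dens_phi[OF zV, of b] linear_scale[OF linear_dirderiv[OF diff_density[OF N.x]], of s \<eta>]
      by (simp add: s)
    then have "dirderiv \<phi> b z = 0" using N.transversal s by simp
    then show "b = 0"
      using inj_phi[OF zV] linear_inj_iff_eq_0[OF linear_dirderiv[OF d\<phi>(1)[OF zV]]] by blast
  qed
  obtain \<eta> where "null_direction f \<nu> W (\<phi> y) \<eta>" using nd[OF y'] by blast
  then interpret N: null_direction f \<nu> W "\<phi> y" \<eta> .
  have eta_range: "\<eta> \<notin> range (\<lambda>b. dirderiv \<phi> b y)" using dens_phi[OF y'] N.transversal by auto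
  \<comment> \<open>Modulo the null vector, every vector is tangent to the singular set, so \<open>f\<close> and \<open>f \<circ> \<phi>\<close> have the same tangent
    space.\<close>
  have split: "\<exists>b. dirderiv f a (\<phi> y) = dirderiv (f \<circ> \<phi>) b y" for a
  proof -
    obtain b s where a: "a = dirderiv \<phi> b y + s *\<^sub>R \<eta>"
      using hyperplane_complement[OF linear_dirderiv[OF d\<phi>(1)[OF y']] inj_phi[OF y'] card eta_range] by blast
    note lf = linear_dirderiv[OF diff_f(1)[OF N.x]]
    have "dirderiv f a (\<phi> y) = dirderiv f (dirderiv \<phi> b y) (\<phi> y)"
      unfolding a linear_add[OF lf] linear_scale[OF lf] N.null by simp
    then show ?thesis using dF[OF y'] by metis
  qed
  define P where "P a b = dirderiv (dirderiv f (dirderiv \<phi> b y)) (dirderiv \<phi> a y) (\<phi> y) \<bullet> N.n" for a b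
  have D2F: "dirderiv (dirderiv (f \<circ> \<phi>) b) a y
     = dirderiv f (dirderiv (dirderiv \<phi> b) a y) (\<phi> y)
      + dirderiv (dirderiv f (dirderiv \<phi> b y)) (dirderiv \<phi> a y) (\<phi> y)" for a b
  proof -
    have im: "\<phi> ` V' \<subseteq> W" using in_V' by auto
    note field = dirderiv_field_along[OF open_W Ck_f N.x V' y' im d\<phi>(1)[OF y'] d\<phi>(2)[OF y']]
    have "dirderiv (dirderiv (f \<circ> \<phi>) b) a y = dirderiv (\<lambda>z. dirderiv f (dirderiv \<phi> b z) (\<phi> z)) a y"
      by (rule dirderiv_cong_open(2)[OF V' y' dF[symmetric] field(1)])
    then show ?thesis unfolding field(2) .
  qed
  have D2F_n: "dirderiv (dirderiv (f \<circ> \<phi>) b) a y \<bullet> N.n = P a b" for a b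
    unfolding D2F P_def inner_add_left using N.tangent_n by simp
  have D2F_nu: "dirderiv (dirderiv (f \<circ> \<phi>) b) a y \<bullet> \<nu> (\<phi> y) = 0" for a b
    unfolding D2F inner_add_left tangent_normal[OF N.x]
    using II_eq[OF N.x] vanish[OF y'] by (simp add: II_def)
  have curv: "sectional_curvature (induced_metric (f \<circ> \<phi>)) y v w
      = ((P v v * P w w - (P v w)\<^sup>2) / (N.n \<bullet> N.n)) /
        (induced_metric (f \<circ> \<phi>) y v v * induced_metric (f \<circ> \<phi>) y w w - (induced_metric (f \<circ> \<phi>) y v w)\<^sup>2)"
    for v w
    unfolding D2F_n[symmetric]
  proof (rule gauss_equation_normal_line[OF V' _ _ y' N.n_nonzero])
    show "Ck_on 3 V' (f \<circ> \<phi>)"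
      by (rule Ck_on_compose[OF V' open_W _ Ck_on_subset[OF Ck_phi] Ck_f]) (use in_V' in auto)
    show "inj (frechet_derivative (f \<circ> \<phi>) (at z))" if "z \<in> V'" for z using F_inj[OF that] by simp
    show "dirderiv (f \<circ> \<phi>) u y \<bullet> N.n = 0" for u unfolding dF[OF y'] by (rule N.tangent_n)
    fix a b z
    assume orth: "\<And>u. (dirderiv (dirderiv (f \<circ> \<phi>) b) a y - dirderiv (f \<circ> \<phi>) z y) \<bullet> dirderiv (f \<circ> \<phi>) u y = 0"
    show "\<exists>\<mu>. dirderiv (dirderiv (f \<circ> \<phi>) b) a y - dirderiv (f \<circ> \<phi>) z y = \<mu> *\<^sub>R N.n"
    proof (rule N.normal_line)
      show "(dirderiv (dirderiv (f \<circ> \<phi>) b) a y - dirderiv (f \<circ> \<phi>) z y) \<bullet> dirderiv f v (\<phi> y) = 0" for v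
        using split[of v] orth by metis
      show "(dirderiv (dirderiv (f \<circ> \<phi>) b) a y - dirderiv (f \<circ> \<phi>) z y) \<bullet> \<nu> (\<phi> y) = 0"
        unfolding inner_diff_left D2F_nu dF[OF y'] tangent_normal[OF N.x] by simp
    qed
  qed
  have vanish_deriv: "dirderiv (\<lambda>z. dirderiv f a z \<bullet> dirderiv \<nu> b z) (dirderiv \<phi> c y) (\<phi> y) = 0" for a b c
  proof -
    let ?G = "\<lambda>z. dirderiv f a z \<bullet> dirderiv \<nu> b z"
    have "dirderiv (?G \<circ> \<phi>) c y = dirderiv (\<lambda>z. 0) c y"
      by (rule dirderiv_cong_open(2)[OF V' y']) (use vanish in auto)
    then show ?thesis
      using dirderiv_compose(2)[OF d\<phi>(1)[OF y'] dirderiv_inner(1)[OF diff_f(2)[OF N.x] diff_nu(2)[OF N.x]]]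
      by simp
  qed
  define Q where "Q a b = - (N.h \<bullet> N.n) * P a b" for a b
  have lin_phi: "linear (\<lambda>b. dirderiv \<phi> b y)" by (rule linear_dirderiv[OF d\<phi>(1)[OF y']])
  have lin2: "linear (\<lambda>a. dirderiv (dirderiv f b) a (\<phi> y))" for b
    by (rule linear_dirderiv[OF diff_f(2)[OF N.x]])
  have Q_add: "Q (a + b) c = Q a c + Q b c" for a b c
    unfolding Q_def P_def linear_add[OF lin_phi] linear_add[OF lin2] by (simp add: inner_add_left algebra_simps)
  have Q_scale: "Q (r *\<^sub>R a) b = r * Q a b" for r a b
    unfolding Q_def P_def linear_scale[OF lin_phi] linear_scale[OF lin2] by simp
  have Q_sym: "Q a b = Q b a" for a b
    unfolding Q_def P_def using symmetric_f[OF N.x] by simp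
  have Q_lower: "\<delta> * ((N.h \<bullet> N.h) * (w \<bullet> w) - (N.h \<bullet> w)\<^sup>2) \<le> Q b b \<and> (N.h \<bullet> w)\<^sup>2 < (N.h \<bullet> N.h) * (w \<bullet> w)"
    if b: "b \<noteq> 0" and w: "w = dirderiv f (dirderiv \<phi> b y) (\<phi> y)" for b w
  proof -
    have "w \<noteq> 0"
      using b F_inj[OF y'] linear_inj_iff_eq_0[OF lin_F[OF y']] unfolding dF[OF y'] w by blast
    then show ?thesis
      using N.singular_curvature_bound[OF \<delta>(2) vanish[OF y'] vanish_deriv] N.gram_tangent_h_pos
      unfolding w Q_def P_def by blast
  qed
  have Q_nonneg: "0 \<le> Q b b" for b
  proof (cases "b = 0")
    case True
    then show ?thesis using Q_scale[of 0 b b] by simp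
  next
    case False
    have "0 \<le> \<delta> * ((N.h \<bullet> N.h) * (w \<bullet> w) - (N.h \<bullet> w)\<^sup>2)"
      if "w = dirderiv f (dirderiv \<phi> b y) (\<phi> y)" for w
      using Q_lower[OF False that] \<delta>(1) by (intro mult_nonneg_nonneg) auto
    then show ?thesis using Q_lower[OF False refl] order_trans by blast
  qed
  have Q_pos: "0 < Q b b" if "\<delta> > 0" "b \<noteq> 0" for b
  proof -
    have "0 < \<delta> * ((N.h \<bullet> N.h) * (w \<bullet> w) - (N.h \<bullet> w)\<^sup>2)"
      if "w = dirderiv f (dirderiv \<phi> b y) (\<phi> y)" for w
      using Q_lower[OF \<open>b \<noteq> 0\<close> that] \<open>\<delta> > 0\<close> by (intro mult_pos_pos) auto
    then show ?thesis using Q_lower[OF \<open>b \<noteq> 0\<close> refl] less_le_trans by blast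
  qed
  obtain v w where vw: "v \<noteq> w" "independent {v, w}"
    and \<kappa>_eq: "\<kappa> = sectional_curvature (induced_metric (f \<circ> \<phi>)) y v w"
    using \<kappa> unfolding sectional_curvatures_at_def by blast
  have gram_pos: "0 < induced_metric (f \<circ> \<phi>) y v v * induced_metric (f \<circ> \<phi>) y w w - (induced_metric (f \<circ> \<phi>) y v w)\<^sup>2"
    using gram_determinant_pos[OF lin_F[OF y'] F_inj[OF y'] vw] by (simp add: induced_metric_def)
  have n_pos: "0 < N.n \<bullet> N.n" using N.n_nonzero by simp
  have h2: "0 < (N.h \<bullet> N.n)\<^sup>2" using N.h_n by simp
  have QP: "Q v v * Q w w - (Q v w)\<^sup>2 = (N.h \<bullet> N.n)\<^sup>2 * (P v v * P w w - (P v w)\<^sup>2)"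
    by (simp add: Q_def power2_eq_square algebra_simps)
  show "\<kappa> \<ge> 0"
  proof -
    have "0 \<le> Q v v * Q w w - (Q v w)\<^sup>2"
      using quadratic_form_discriminant(1)[of Q, OF Q_add Q_scale Q_sym Q_nonneg] by simp
    then have "0 \<le> P v v * P w w - (P v w)\<^sup>2" unfolding QP using h2 by (simp only: zero_le_mult_iff) linarith
    then show ?thesis unfolding \<kappa>_eq curv using gram_pos n_pos by (intro divide_nonneg_pos)
  qed
  show "\<kappa> > 0" if "\<delta> > 0"
  proof -
    have "0 < Q v v * Q w w - (Q v w)\<^sup>2"
      using quadratic_form_discriminant(2)[of Q, OF Q_add Q_scale Q_sym Q_pos[OF that] vw] by simp
    then have "0 < P v v * P w w - (P v w)\<^sup>2" unfolding QP using h2 by (simp only: zero_less_mult_iff) linarith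
    then show ?thesis unfolding \<kappa>_eq curv using gram_pos n_pos by (intro divide_pos_pos)
  qed
qed

end

text \<open>Globally, the patch and the normal field are those witnessing non-degeneracy at the point considered.
  Both parts of the theorem are instances, with \<open>\<delta> = 0\<close> for the first.\<close>

lemma singular_set_curvature:
  fixes f :: "real ^ 'm \<Rightarrow> real ^ 'm option" and \<phi> :: "real ^ 'k \<Rightarrow> real ^ 'm"
  assumes card: "CARD('k) + 1 = CARD('m)" and front: "front U f"
    and A2: "\<And>p. p \<in> singular_set U f \<Longrightarrow> A2_singular U f p"
    and \<delta>: "\<delta> \<ge> 0"
    and K: "\<forall>p \<in> U - singular_set U f. \<forall>\<kappa> \<in> sectional_curvatures_at (induced_metric f) p. \<delta> \<le> \<kappa>"
    and \<phi>: "local_parametrization (singular_set U f) V \<phi>"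
    and y: "y \<in> V" and \<kappa>: "\<kappa> \<in> sectional_curvatures_at (induced_metric (f \<circ> \<phi>)) y"
  shows "\<kappa> \<ge> 0" and "\<delta> > 0 \<Longrightarrow> \<kappa> > 0"
proof -
  let ?S = "singular_set U f"
  have V: "open V" "smooth_on V \<phi>" "\<And>y. y \<in> V \<Longrightarrow> immersion_at \<phi> y" "\<phi> ` V \<subseteq> ?S"
    using \<phi> openin_imp_subset unfolding local_parametrization_def by blast+
  have "\<phi> y \<in> ?S" using V(4) y by blast
  then have "nondegenerate_singular U f (\<phi> y)" using A2 unfolding A2_singular_def by simp
  then obtain W \<nu> where W: "open W" "\<phi> y \<in> W" "W \<subseteq> U" "front_normal f W \<nu>"
      "frechet_derivative (signed_density f \<nu>) (at (\<phi> y)) \<noteq> (\<lambda>_. 0)"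
    unfolding nondegenerate_singular_def by blast
  have "Ck_on k W f" for k
    using front Ck_on_subset[OF _ W(3), of k f] by (simp add: front_def smooth_on_def)
  then have "smooth_on W f" by (simp add: smooth_on_def)
  then interpret front_patch f \<nu> W using W by unfold_locales
  obtain e where e: "dirderiv dens e (\<phi> y) \<noteq> 0" using W(5) by auto
  have dens0: "dens z = 0" if "z \<in> ?S" "z \<in> W" for z
    using density_singular[OF that(2)] that(1) by (simp add: singular_set_def)
  have span: "{v. dirderiv f v z = 0} + tangent_space_at ?S z = UNIV" if "z \<in> ?S" "z \<in> W" for z
    using A2[OF that(1)] by (simp add: A2_singular_def)
  have ge: "curvature_ge \<delta>"
  proof (rule curvature_geI)
    fix z \<kappa>' assume z: "z \<in> W" "dens z \<noteq> 0" and "\<kappa>' \<in> sectional_curvatures_at (induced_metric f) z"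
    moreover have "z \<in> U - ?S" using z dens0 W(3) by blast
    ultimately show "\<delta> \<le> \<kappa>'" using K by blast
  qed
  note curv = singular_submanifold_curvature[OF V(1,2) _ V(4) y W(2) card _ _ e \<delta> ge \<kappa>]
  show "\<kappa> \<ge> 0" by (rule curv(1)) (use V(3) dens0 span in blast)+
  show "\<kappa> > 0" if "\<delta> > 0" by (rule curv(2)) (use V(3) dens0 span that in blast)+
qed

theorem corollary0p2:
  fixes f :: "real ^ 'm \<Rightarrow> real ^ 'm option" and U :: "(real ^ 'm) set"
  assumes "CARD('m) \<ge> 3"
    and "CARD('k) + 1 = CARD('m)"
    and "open U" and "connected U"
    and "front U f"
    and "\<And>p. p \<in> singular_set U f \<Longrightarrow> A2_singular U f p"
  shows
    "((\<forall>p \<in> U - singular_set U f. \<forall>\<kappa> \<in> sectional_curvatures_at (induced_metric f) p. \<kappa> > 0) \<longrightarrow>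
      (\<forall>(V :: (real ^ 'k) set) \<phi>. local_parametrization (singular_set U f) V \<phi> \<longrightarrow>
         (\<forall>y\<in>V. \<forall>\<kappa> \<in> sectional_curvatures_at (induced_metric (f \<circ> \<phi>)) y. \<kappa> \<ge> 0)))
   \<and> ((\<exists>\<delta>>0. \<forall>p \<in> U - singular_set U f. \<forall>\<kappa> \<in> sectional_curvatures_at (induced_metric f) p. \<kappa> \<ge> \<delta>) \<longrightarrow>
      (\<forall>(V :: (real ^ 'k) set) \<phi>. local_parametrization (singular_set U f) V \<phi> \<longrightarrow>
         (\<forall>y\<in>V. \<forall>\<kappa> \<in> sectional_curvatures_at (induced_metric (f \<circ> \<phi>)) y. \<kappa> > 0)))"
proof (intro conjI impI allI ballI)
  fix V :: "(real ^ 'k) set" and \<phi> y \<kappa>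
  assume K: "\<forall>p \<in> U - singular_set U f. \<forall>\<kappa> \<in> sectional_curvatures_at (induced_metric f) p. \<kappa> > 0"
    and rest: "local_parametrization (singular_set U f) V \<phi>" "y \<in> V"
      "\<kappa> \<in> sectional_curvatures_at (induced_metric (f \<circ> \<phi>)) y"
  have K0: "\<forall>p \<in> U - singular_set U f. \<forall>\<kappa> \<in> sectional_curvatures_at (induced_metric f) p. 0 \<le> \<kappa>"
    using K less_imp_le by blast
  show "\<kappa> \<ge> 0"
    by (rule singular_set_curvature(1)[OF assms(2,5,6) order_refl K0 rest])
next
  fix V :: "(real ^ 'k) set" and \<phi> y \<kappa>
  assume "\<exists>\<delta>>0. \<forall>p \<in> U - singular_set U f. \<forall>\<kappa> \<in> sectional_curvatures_at (induced_metric f) p. \<kappa> \<ge> \<delta>"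
    and rest: "local_parametrization (singular_set U f) V \<phi>" "y \<in> V"
      "\<kappa> \<in> sectional_curvatures_at (induced_metric (f \<circ> \<phi>)) y"
  then obtain \<delta> where \<delta>: "\<delta> > 0"
    "\<forall>p \<in> U - singular_set U f. \<forall>\<kappa> \<in> sectional_curvatures_at (induced_metric f) p. \<delta> \<le> \<kappa>" by blast
  show "\<kappa> > 0"
    by (rule singular_set_curvature(2)[OF assms(2,5,6) less_imp_le[OF \<delta>(1)] \<delta>(2) rest \<delta>(1)])
qed

end
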